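(* Let $p\in(0,1)$ be a constant and let $\mathbf G_n\sim G(n,p)$. Let $\tau$ be a closed term of the language $\mathrm{Agg}_{\mathcal F_{\mathrm{rlpoly}}}$, and write $\tau_n=[\![\tau]\!]_{\mathbf G_n}$. Then either (i) $\tau_n=0$ with high probability, and $\tau_n\stackrel{L_q}{\to}0$ as $n\to\infty$ for every $q>0$; or (ii) there exist $c>0$ and $\gamma\in\mathbb R$ such that $\mathbb E\tau_n=(c+o(1))n^{\gamma}$ as $n\to\infty$.
   Context: $G(n,p)$ is the random graph on vertex set $[n]=\{1,\dots,n\}$ in which each pair of distinct vertices is an edge independently with probability $p$. "With high probability" means with probability tending to $1$ as $n\to\infty$. $X_n\stackrel{L_q}{\to}X$ means $\mathbb E|X_n-X|^q\to0$. Graphs are finite, undirected, without loops. Relative Lipschitz functions. A function $f:\mathbb R_{>0}^m\to\mathbb R_{>0}$ is relative Lipschitz if there is $C>0$ with $\frac{|f(x)-f(y)|}{f(x)+f(y)}\le C\frac{\|x-y\|}{\|x+y\|}$ for all $x,y\in\mathbb R_{>0}^m$ (Euclidean norm). For $f:\mathbb R_{\ge0}^m\to\mathbb R_{\ge0}$ and $\varnothing\ne I=\{j_1,\dots,j_{m'}\}\subseteq[m]$, the $I$-specialisation $f_I:\mathbb R_{>0}^{m'}\to\mathbb R_{\ge0}$ is $f_I(y)=f(x)$, where $x_{j_i}=y_i$ for $i\in[m']$ and $x_j=0$ for $j\notin I$. A function $f:\mathbb R_{\ge0}^m\to\mathbb R_{\ge0}$ is relative Lipschitz if every specialisation is either positive-valued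 and relative Lipschitz, or identically zero. Asymptotically polynomial functions. A function $f:\mathbb R_{>0}^m\to\mathbb R_{>0}$ is asymptotically polynomial if for any positive constants $c_1,\dots,c_m$, real constants $\gamma_1,\dots,\gamma_m$, and sequence $a_k=((c_1+o(1))k^{\gamma_1},\dots,(c_m+o(1))k^{\gamma_m})$ there exist $c>0$ and $\gamma\in\mathbb R$ with $f(a_k)=(c+o(1))k^\gamma$ as $k\to\infty$. A function $f:\mathbb R_{\ge0}^m\to\mathbb R_{\ge0}$ is asymptotically polynomial if every specialisation is either positive-valued and asymptotically polynomial, or identically zero. $\mathcal F_{\mathrm{rlpoly}}$ is the set of all functions $f:\mathbb R_{\ge0}^m\to\mathbb R_{\ge0}$, $m\ge1$, that are both relative Lipschitz and asymptotically polynomial. The language $\mathrm{Agg}_{\mathcal F}$. For a class $\mathcal F$ of functions, terms with node variables are built inductively and interpreted in a graph $G$ with an assignment of vertices of $G$ to the free variables as follows. - Atomic terms: constants $c\in\mathbb R_{\ge0}$ (value $c$); $\mathrm E(u,v)$ (value $1$ if $\{u,v\}\in E(G)$, else $0$); $u=v$ (value $1$ if equal, else $0$). - $f(\tau_1,\dots,\tau_m)$ for $f\in\mathcal F$ of arity $m$: apply $f$ to the values. - $\mathrm{Avg}_v\,\tau(\bar u,v)$: value $\frac1{|V(G)|}\sum_{v\in V(G)}\tau(\bar u,v)$. - $\mathrm{LAvg}_{w\mathrm Ev}\,\tau(w,\bar u,v)$ (free variables $w,\bar u$): the average of $\tau(w,\bar u,v)$ over the neighbours $v$ of $w$, and $0$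 if $w$ has no neighbours. - $\mathrm{Max}_v\,\tau(\bar u,v)$, $\mathrm{Min}_v\,\tau(\bar u,v)$, $\Sigma_v\,\tau(\bar u,v)$: the maximum, minimum and sum over all $v\in V(G)$. A term is closed if it has no free variables; $[\![\tau]\!]_G$ denotes the value of a closed term $\tau$ in $G$. *)

theory Defs
  imports "HOL-Probability.Probability"
begin

section \<open>Asymptotics and classes of functions\<close>

text \<open>\<open>s k = (c + o(1)) * k powr \<gamma>\<close> as \<open>k \<rightarrow> \<infinity>\<close>.\<close>

definition poly_growth :: "(nat \<Rightarrow> real) \<Rightarrow> real \<Rightarrow> real \<Rightarrow> bool" where
  "poly_growth s c \<gamma> \<longleftrightarrow> (\<lambda>k. s k / real k powr \<gamma>) \<longlonglongrightarrow> c"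

text \<open>
  A vector in \<open>\<real>\<^sup>m\<close> is a list of length \<open>m\<close>, so coordinates are numbered from 0, and a function of
  arity \<open>m\<close> is a function on lists of which only the values on \<open>nonneg_vecs m\<close> (or \<open>pos_vecs m\<close>)
  are ever used.
\<close>

definition nonneg_vecs :: "nat \<Rightarrow> real list set" where
  "nonneg_vecs m = {x. length x = m \<and> (\<forall>t\<in>set x. t \<ge> 0)}"

definition pos_vecs :: "nat \<Rightarrow> real list set" where
  "pos_vecs m = {x. length x = m \<and> (\<forall>t\<in>set x. t > 0)}"

definition rel_lipschitz_pos :: "nat \<Rightarrow> (real list \<Rightarrow> real) \<Rightarrow> bool" where
  "rel_lipschitz_pos m f \<longleftrightarrow>
     (\<exists>C>0. \<forall>x\<in>pos_vecs m. \<forall>y\<in>pos_vecs m.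
        \<bar>f x - f y\<bar> / (f x + f y)
          \<le> C * (L2_set (\<lambda>i. x ! i - y ! i) {..<m} / L2_set (\<lambda>i. x ! i + y ! i) {..<m}))"

definition asymp_poly_pos :: "nat \<Rightarrow> (real list \<Rightarrow> real) \<Rightarrow> bool" where
  "asymp_poly_pos m f \<longleftrightarrow>
     (\<forall>(c :: nat \<Rightarrow> real) (\<gamma> :: nat \<Rightarrow> real) (a :: nat \<Rightarrow> real list).
        (\<forall>i<m. c i > 0) \<and> (\<forall>k. a k \<in> pos_vecs m) \<and>
        (\<forall>i<m. poly_growth (\<lambda>k. a k ! i) (c i) (\<gamma> i))
        \<longrightarrow> (\<exists>c'>0. \<exists>\<gamma>'. poly_growth (\<lambda>k. f (a k)) c' \<gamma>'))"

text \<open>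
  For \<open>I = {j\<^sub>0 < j\<^sub>1 < \<dots>} \<subseteq> {..<m}\<close> the position of \<open>j \<in> I\<close> in this enumeration is the number of
  elements of \<open>I\<close> below \<open>j\<close>; so the vector given to \<open>f\<close> has \<open>y ! i\<close> in coordinate \<open>j\<^sub>i\<close>
  and 0 outside \<open>I\<close>.
\<close>

definition specialisation :: "nat \<Rightarrow> nat set \<Rightarrow> (real list \<Rightarrow> real) \<Rightarrow> real list \<Rightarrow> real" where
  "specialisation m I f y =
     f (map (\<lambda>j. if j \<in> I then y ! card {i \<in> I. i < j} else 0) [0..<m])"

definition rel_lipschitz :: "nat \<Rightarrow> (real list \<Rightarrow> real) \<Rightarrow> bool" where
  "rel_lipschitz m f \<longleftrightarrow>
     (\<forall>I. I \<noteq> {} \<and> I \<subseteq> {..<m} \<longrightarrow>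
        (\<forall>y\<in>pos_vecs (card I). specialisation m I f y > 0) \<and>
          rel_lipschitz_pos (card I) (specialisation m I f)
        \<or> (\<forall>y\<in>pos_vecs (card I). specialisation m I f y = 0))"

definition asymp_poly :: "nat \<Rightarrow> (real list \<Rightarrow> real) \<Rightarrow> bool" where
  "asymp_poly m f \<longleftrightarrow>
     (\<forall>I. I \<noteq> {} \<and> I \<subseteq> {..<m} \<longrightarrow>
        (\<forall>y\<in>pos_vecs (card I). specialisation m I f y > 0) \<and>
          asymp_poly_pos (card I) (specialisation m I f)
        \<or> (\<forall>y\<in>pos_vecs (card I). specialisation m I f y = 0))"

text \<open>A class of functions is a family indexed by the arity.\<close>

type_synonym fun_class = "nat \<Rightarrow> (real list \<Rightarrow> real) set"

definition F_rlpoly :: fun_class where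
  "F_rlpoly m =
     {f. m \<ge> 1 \<and> (\<forall>x\<in>nonneg_vecs m. f x \<ge> 0) \<and> rel_lipschitz m f \<and> asymp_poly m f}"


section \<open>The language\<close>

text \<open>Node variables are natural numbers.\<close>

datatype agg_term =
    Const real
  | Edge nat nat
  | Equal nat nat
  | Fn "real list \<Rightarrow> real" "agg_term list"
  | Avg nat agg_term
  | LAvg nat nat agg_term
  | MaxT nat agg_term
  | MinT nat agg_term
  | SumT nat agg_term

inductive_set Agg :: "fun_class \<Rightarrow> agg_term set" for \<F> :: fun_class where
  "c \<ge> 0 \<Longrightarrow> Const c \<in> Agg \<F>"
| "Edge u v \<in> Agg \<F>"
| "Equal u v \<in> Agg \<F>"
| "f \<in> \<F> (length ts) \<Longrightarrow> \<forall>t\<in>set ts. t \<in> Agg \<F> \<Longrightarrow> Fn f ts \<in> Agg \<F>"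
| "t \<in> Agg \<F> \<Longrightarrow> Avg v t \<in> Agg \<F>"
| "t \<in> Agg \<F> \<Longrightarrow> w \<noteq> v \<Longrightarrow> LAvg w v t \<in> Agg \<F>"
| "t \<in> Agg \<F> \<Longrightarrow> MaxT v t \<in> Agg \<F>"
| "t \<in> Agg \<F> \<Longrightarrow> MinT v t \<in> Agg \<F>"
| "t \<in> Agg \<F> \<Longrightarrow> SumT v t \<in> Agg \<F>"

text \<open>In \<open>LAvg w v t\<close> the variable \<open>v\<close> is bound and ranges over the neighbours of \<open>w\<close>.\<close>

fun free_vars :: "agg_term \<Rightarrow> nat set" where
  "free_vars (Const c) = {}"
| "free_vars (Edge u v) = {u, v}"
| "free_vars (Equal u v) = {u, v}"
| "free_vars (Fn f ts) = (\<Union>t\<in>set ts. free_vars t)"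
| "free_vars (Avg v t) = free_vars t - {v}"
| "free_vars (LAvg w v t) = insert w (free_vars t - {v})"
| "free_vars (MaxT v t) = free_vars t - {v}"
| "free_vars (MinT v t) = free_vars t - {v}"
| "free_vars (SumT v t) = free_vars t - {v}"

definition closed_term :: "agg_term \<Rightarrow> bool" where
  "closed_term t \<longleftrightarrow> free_vars t = {}"

text \<open>A graph is a pair of a vertex set and a set of edges, which are two-element sets of vertices.\<close>

type_synonym 'v ugraph = "'v set \<times> 'v set set"

definition neighbours :: "'v ugraph \<Rightarrow> 'v \<Rightarrow> 'v set" where
  "neighbours G a = {b \<in> fst G. {a, b} \<in> snd G}"

fun eval_term :: "'v ugraph \<Rightarrow> (nat \<Rightarrow> 'v) \<Rightarrow> agg_term \<Rightarrow> real" where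
  "eval_term G \<sigma> (Const c) = c"
| "eval_term G \<sigma> (Edge u v) = (if {\<sigma> u, \<sigma> v} \<in> snd G then 1 else 0)"
| "eval_term G \<sigma> (Equal u v) = (if \<sigma> u = \<sigma> v then 1 else 0)"
| "eval_term G \<sigma> (Fn f ts) = f (map (\<lambda>t. eval_term G \<sigma> t) ts)"
| "eval_term G \<sigma> (Avg v t) = (\<Sum>a\<in>fst G. eval_term G (\<sigma>(v := a)) t) / real (card (fst G))"
| "eval_term G \<sigma> (LAvg w v t) =
     (if neighbours G (\<sigma> w) = {} then 0
      else (\<Sum>a\<in>neighbours G (\<sigma> w). eval_term G (\<sigma>(v := a)) t)
             / real (card (neighbours G (\<sigma> w))))"
| "eval_term G \<sigma> (MaxT v t) = Max ((\<lambda>a. eval_term G (\<sigma>(v := a)) t) ` fst G)"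
| "eval_term G \<sigma> (MinT v t) = Min ((\<lambda>a. eval_term G (\<sigma>(v := a)) t) ` fst G)"
| "eval_term G \<sigma> (SumT v t) = (\<Sum>a\<in>fst G. eval_term G (\<sigma>(v := a)) t)"

lemma eval_term_cong:
  "(\<And>v. v \<in> free_vars t \<Longrightarrow> \<sigma> v = \<sigma>' v) \<Longrightarrow> eval_term G \<sigma> t = eval_term G \<sigma>' t"
proof (induction t arbitrary: \<sigma> \<sigma>')
  case (Fn f ts)
  have "eval_term G \<sigma> t = eval_term G \<sigma>' t" if "t \<in> set ts" for t
    using that Fn.prems by (intro Fn.IH) auto
  then have "map (eval_term G \<sigma>) ts = map (eval_term G \<sigma>') ts"
    by simp
  then show ?case by (simp only: eval_term.simps)
next
  case (Avg v t)
  have "eval_term G (\<sigma>(v := a)) t = eval_term G (\<sigma>'(v := a)) t" for a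
    using Avg by (intro Avg.IH) auto
  then show ?case by simp
next
  case (LAvg w v t)
  have "eval_term G (\<sigma>(v := a)) t = eval_term G (\<sigma>'(v := a)) t" for a
    using LAvg by (intro LAvg.IH) auto
  moreover have "\<sigma> w = \<sigma>' w" using LAvg by simp
  ultimately show ?case by simp
next
  case (MaxT v t)
  have "eval_term G (\<sigma>(v := a)) t = eval_term G (\<sigma>'(v := a)) t" for a
    using MaxT by (intro MaxT.IH) auto
  then show ?case by simp
next
  case (MinT v t)
  have "eval_term G (\<sigma>(v := a)) t = eval_term G (\<sigma>'(v := a)) t" for a
    using MinT by (intro MinT.IH) auto
  then show ?case by simp
next
  case (SumT v t)
  have "eval_term G (\<sigma>(v := a)) t = eval_term G (\<sigma>'(v := a)) t" for a
    using SumT by (intro SumT.IH) auto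
  then show ?case by simp
qed simp_all

text \<open>By \<open>eval_term_cong\<close> the value of a closed term does not depend on the assignment.\<close>

definition closed_value :: "'v ugraph \<Rightarrow> agg_term \<Rightarrow> real" where
  "closed_value G t = eval_term G (\<lambda>_. undefined) t"


section \<open>The random graph\<close>

definition vertex_pairs :: "nat \<Rightarrow> nat set set" where
  "vertex_pairs n = {e. e \<subseteq> {1..n} \<and> card e = 2}"

definition gnp :: "nat \<Rightarrow> real \<Rightarrow> nat ugraph pmf" where
  "gnp n p =
     map_pmf (\<lambda>present. ({1..n}, {e \<in> vertex_pairs n. present e}))
       (Pi_pmf (vertex_pairs n) False (\<lambda>_. bernoulli_pmf p))"

end

theory Submission
  imports Defs
begin

text \<open>
  The type of a tuple of vertices records which entries coincide and which are adjacent. In a graph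
  where every bounded adjacency pattern has the expected proportion of extensions, the value of a term
  on all tuples of a given type is, uniformly, either exactly 0 or \<open>(c + o(1)) n\<^sup>\<gamma>\<close>: the number of
  extensions of a tuple to a larger type is 0, 1 or \<open>(q + o(1)) n\<close>, so all aggregators preserve the
  dichotomy, and asymptotically polynomial functions do too. By Hoeffding's inequality \<open>G(n,p)\<close> fails
  to be such a graph only with probability exponentially small in \<open>n\<close>. Relative Lipschitz functions
  distort logarithms in a controlled way, hence nonzero values of a term lie between \<open>n\<^sup>-\<^sup>K\<close> and
  \<open>n\<^sup>K\<close> on every graph, and the exceptional graphs do not contribute to the expectation.
\<close>

section \<open>Zero-or-power asymptotics along a filter\<close>

text \<open>The obstacle is uniformity: asymptotic polynomiality speaks of single sequences, while
  an aggregator combines the values at all vertices of one graph. Limits are therefore taken along a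
  filter of pairs of a graph and an assignment, and the hypothesis on sequences is upgraded to an
  epsilon-delta statement that can be used along any filter. The first alternative is exact
  vanishing, not smallness, because the hypotheses link no specialisation of a function to another:
  it may jump when an argument becomes 0. The alternatives do not have to exclude each other. For a
  type that no graph realises the filter is trivial and everything holds, so realisability of types
  is never decided. Asymptotic polynomiality controls a function only along power-like sequences and
  says nothing about values on exceptional graphs; there the relative Lipschitz condition takes
  over. Although the moments need only upper bounds, the induction needs two-sided ones: the
  reciprocal is an admissible function and turns small values into large ones.\<close>

definition zero_or_power :: "'a filter \<Rightarrow> ('a \<Rightarrow> real) \<Rightarrow> ('a \<Rightarrow> real) \<Rightarrow> bool" where
  "zero_or_power F N h \<longleftrightarrow>
     (\<forall>\<^sub>F z in F. h z = 0) \<or> (\<exists>c>0. \<exists>\<gamma>. ((\<lambda>z. h z / N z powr \<gamma>) \<longlongrightarrow> c) F)"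

lemma zero_or_power_zero: "(\<forall>\<^sub>F z in F. h z = 0) \<Longrightarrow> zero_or_power F N h"
  by (simp add: zero_or_power_def)

lemma zero_or_power_limit:
  "((\<lambda>z. h z / N z powr \<gamma>) \<longlongrightarrow> c) F \<Longrightarrow> c > 0 \<Longrightarrow> zero_or_power F N h"
  by (auto simp: zero_or_power_def)

lemma zero_or_power_cases [consumes 1, case_names zero power]:
  assumes "zero_or_power F N h"
  obtains "\<forall>\<^sub>F z in F. h z = 0"
  | c \<gamma> where "c > 0" "((\<lambda>z. h z / N z powr \<gamma>) \<longlongrightarrow> c) F"
  using assms by (auto simp: zero_or_power_def)

lemma zero_or_power_cong:
  assumes "\<forall>\<^sub>F z in F. h z = g z" "zero_or_power F N g"
  shows "zero_or_power F N h"
  using assms(2)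
proof (cases rule: zero_or_power_cases)
  case zero
  then show ?thesis using assms(1) by (intro zero_or_power_zero) (auto elim: eventually_elim2)
next
  case (power c \<gamma>)
  have "((\<lambda>z. h z / N z powr \<gamma>) \<longlongrightarrow> c) F"
    by (rule Lim_transform_eventually[OF power(2)]) (use assms(1) in eventually_elim, simp)
  then show ?thesis using power(1) by (rule zero_or_power_limit)
qed

lemma zero_or_power_mono:
  assumes "F \<le> F'" "zero_or_power F' N h"
  shows "zero_or_power F N h"
  using assms(2)
proof (cases rule: zero_or_power_cases)
  case zero
  then show ?thesis using assms(1) by (intro zero_or_power_zero) (auto simp: le_filter_def)
next
  case (power c \<gamma>)
  show ?thesis by (rule zero_or_power_limit[OF tendsto_mono[OF assms(1) power(2)] power(1)])
qed

section \<open>Closure of the dichotomy under arithmetic, maxima and minima\<close>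

context
  fixes F :: "'a filter" and N :: "'a \<Rightarrow> real"
  assumes N_at_top: "filterlim N at_top F"
begin

lemma eventually_N_pos: "\<forall>\<^sub>F z in F. N z > 0"
  using N_at_top by (simp add: filterlim_at_top_dense)

lemma zero_or_power_const: "c \<ge> 0 \<Longrightarrow> zero_or_power F N (\<lambda>_. c)"
proof (cases "c = 0")
  case False
  assume "c \<ge> 0"
  have "((\<lambda>z. c / N z powr 0) \<longlongrightarrow> c) F"
    by (rule tendsto_eventually) (use eventually_N_pos in eventually_elim, simp)
  then show ?thesis by (rule zero_or_power_limit) (use False \<open>c \<ge> 0\<close> in auto)
qed (simp add: zero_or_power_zero)

lemma zero_or_power_N: "zero_or_power F N N"
proof (rule zero_or_power_limit)
  show "((\<lambda>z. N z / N z powr 1) \<longlongrightarrow> 1) F"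
    by (rule tendsto_eventually) (use eventually_N_pos in eventually_elim, simp)
qed simp

lemma zero_or_power_pos:
  assumes "zero_or_power F N h"
  shows "(\<forall>\<^sub>F z in F. h z = 0) \<or> (\<forall>\<^sub>F z in F. h z > 0)"
  using assms
proof (cases rule: zero_or_power_cases)
  case (power c \<gamma>)
  have "\<forall>\<^sub>F z in F. h z / N z powr \<gamma> > 0"
    using order_tendstoD(1)[OF power(2,1)] .
  then have "\<forall>\<^sub>F z in F. h z > 0"
    using eventually_N_pos by eventually_elim (auto simp: zero_less_divide_iff)
  then show ?thesis ..
qed simp

lemma zero_or_power_mult:
  assumes "zero_or_power F N h" "zero_or_power F N g"
  shows "zero_or_power F N (\<lambda>z. h z * g z)"
  using assms(1)
proof (cases rule: zero_or_power_cases)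
  case zero
  then show ?thesis by (intro zero_or_power_zero) (auto elim: eventually_mono)
next
  case h: (power c \<gamma>)
  show ?thesis using assms(2)
  proof (cases rule: zero_or_power_cases)
    case zero
    then show ?thesis by (intro zero_or_power_zero) (auto elim: eventually_mono)
  next
    case (power d \<delta>)
    have "((\<lambda>z. h z * g z / N z powr (\<gamma> + \<delta>)) \<longlongrightarrow> c * d) F"
      using tendsto_mult[OF h(2) power(2)] by (simp add: powr_add)
    then show ?thesis by (rule zero_or_power_limit) (use h power in auto)
  qed
qed

text \<open>The convention \<open>inverse 0 = 0\<close> keeps the zero alternative stable; it agrees
  with the value 0 of a local average over an empty neighbourhood.\<close>

lemma zero_or_power_inverse:
  assumes "zero_or_power F N h"
  shows "zero_or_power F N (\<lambda>z. inverse (h z))"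
  using assms
proof (cases rule: zero_or_power_cases)
  case zero
  then show ?thesis by (intro zero_or_power_zero) (auto elim: eventually_mono)
next
  case (power c \<gamma>)
  have "((\<lambda>z. inverse (h z) / N z powr (- \<gamma>)) \<longlongrightarrow> inverse c) F"
    using tendsto_inverse[OF power(2)] power(1) by (simp add: powr_minus field_simps)
  then show ?thesis by (rule zero_or_power_limit) (use power in auto)
qed

lemma zero_or_power_divide:
  assumes "zero_or_power F N h" "zero_or_power F N g"
  shows "zero_or_power F N (\<lambda>z. h z / g z)"
  using zero_or_power_mult[OF assms(1) zero_or_power_inverse[OF assms(2)]]
  by (simp add: divide_inverse)

lemma tendsto_zero_higher_power:
  assumes "((\<lambda>z. h z / N z powr \<gamma>) \<longlongrightarrow> c) F" "\<gamma> < \<delta>"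
  shows "((\<lambda>z. h z / N z powr \<delta>) \<longlongrightarrow> 0) F"
proof -
  have "((\<lambda>x. x powr (\<gamma> - \<delta>)) \<longlongrightarrow> 0) at_top"
    using assms(2) by (intro tendsto_neg_powr filterlim_ident) auto
  then have "((\<lambda>z. N z powr (\<gamma> - \<delta>)) \<longlongrightarrow> 0) F"
    by (rule filterlim_compose[OF _ N_at_top])
  then have *: "((\<lambda>z. h z / N z powr \<gamma> * N z powr (\<gamma> - \<delta>)) \<longlongrightarrow> 0) F"
    using tendsto_mult[OF assms(1)] by fastforce
  show ?thesis
    by (rule Lim_transform_eventually[OF *])
       (use eventually_N_pos in eventually_elim, simp add: powr_diff)
qed

text \<open>Both functions are measured against the larger of the two exponents; the one of smaller
  order, or the vanishing one, then has limit 0. Sums and maxima become plain limit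
  computations.\<close>

lemma common_exponent:
  assumes "zero_or_power F N h" "zero_or_power F N g"
  obtains "\<forall>\<^sub>F z in F. h z = 0" "\<forall>\<^sub>F z in F. g z = 0"
  | c d \<gamma> where "c \<ge> 0" "d \<ge> 0" "c > 0 \<or> d > 0"
      "((\<lambda>z. h z / N z powr \<gamma>) \<longlongrightarrow> c) F" "((\<lambda>z. g z / N z powr \<gamma>) \<longlongrightarrow> d) F"
proof -
  have zero: "((\<lambda>z. k z / N z powr \<gamma>) \<longlongrightarrow> 0) F" if "\<forall>\<^sub>F z in F. k z = 0" for k :: "'a \<Rightarrow> real" and \<gamma>
    by (rule tendsto_eventually) (use that in eventually_elim, simp)
  show thesis
    using assms(1)
  proof (cases rule: zero_or_power_cases)
    case h: zero
    show thesis using assms(2)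
    proof (cases rule: zero_or_power_cases)
      case zero
      with h show thesis by (rule that(1))
    next
      case (power d \<delta>)
      show thesis by (rule that(2)[of 0 d \<delta>]) (use power zero[OF h] in auto)
    qed
  next
    case h: (power c \<gamma>)
    show thesis using assms(2)
    proof (cases rule: zero_or_power_cases)
      case z: zero
      show thesis by (rule that(2)[of c 0 \<gamma>]) (use h zero[OF z] in auto)
    next
      case (power d \<delta>)
      consider "\<gamma> < \<delta>" | "\<gamma> = \<delta>" | "\<delta> < \<gamma>" by linarith
      then show thesis
      proof cases
        case 1
        show thesis
          by (rule that(2)[of 0 d \<delta>]) (use power tendsto_zero_higher_power[OF h(2) 1] in auto)
      next
        case 2
        show thesis by (rule that(2)[of c d \<delta>]) (use h power 2 in auto)
      next
        case 3
        show thesis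
          by (rule that(2)[of c 0 \<gamma>]) (use h tendsto_zero_higher_power[OF power(2) 3] in auto)
      qed
    qed
  qed
qed

lemma zero_or_power_add:
  assumes "zero_or_power F N h" "zero_or_power F N g"
  shows "zero_or_power F N (\<lambda>z. h z + g z)"
  using assms
proof (cases rule: common_exponent)
  case 1
  then show ?thesis by (intro zero_or_power_zero) (auto elim: eventually_elim2)
next
  case (2 c d \<gamma>)
  have "((\<lambda>z. (h z + g z) / N z powr \<gamma>) \<longlongrightarrow> c + d) F"
    using tendsto_add[OF 2(4,5)] by (simp add: add_divide_distrib)
  then show ?thesis by (rule zero_or_power_limit) (use 2 in auto)
qed

lemma zero_or_power_max:
  assumes "zero_or_power F N h" "zero_or_power F N g"
  shows "zero_or_power F N (\<lambda>z. max (h z) (g z))"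
  using assms
proof (cases rule: common_exponent)
  case 1
  then show ?thesis by (intro zero_or_power_zero) (auto elim: eventually_elim2)
next
  case (2 c d \<gamma>)
  have *: "max x y / N z powr \<gamma> = max (x / N z powr \<gamma>) (y / N z powr \<gamma>)" for x y z
    by (cases "N z = 0") (auto simp: max_def divide_le_cancel)
  have "((\<lambda>z. max (h z) (g z) / N z powr \<gamma>) \<longlongrightarrow> max c d) F"
    using tendsto_max[OF 2(4,5)] by (simp add: *)
  then show ?thesis by (rule zero_or_power_limit) (use 2 in auto)
qed

text \<open>The common exponent is the larger one, whereas a minimum may follow the smaller. So if
  the limits differ, the minimum is eventually identified with the function of smaller limit, whose
  own dichotomy is inherited; equal limits are both positive and can be compared directly.\<close>

lemma zero_or_power_min:
  assumes "zero_or_power F N h" "zero_or_power F N g"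
  shows "zero_or_power F N (\<lambda>z. min (h z) (g z))"
  using assms
proof (cases rule: common_exponent)
  case 1
  then show ?thesis by (intro zero_or_power_zero) (auto elim: eventually_elim2)
next
  case (2 c d \<gamma>)
  consider "c < d" | "d < c" | "c = d" by linarith
  then show ?thesis
  proof cases
    case 1
    then obtain e where e: "c < e" "e < d" using dense by blast
    have "\<forall>\<^sub>F z in F. min (h z) (g z) = h z"
      using order_tendstoD(2)[OF 2(4) e(1)] order_tendstoD(1)[OF 2(5) e(2)] eventually_N_pos
    proof eventually_elim
      case (elim z)
      then have "h z / N z powr \<gamma> < g z / N z powr \<gamma>" by linarith
      with elim show ?case by (simp add: divide_less_cancel)
    qed
    then show ?thesis using assms(1) by (rule zero_or_power_cong)
  next
    case gt: 2
    then obtain e where e: "d < e" "e < c" using dense by blast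
    have "\<forall>\<^sub>F z in F. min (h z) (g z) = g z"
      using order_tendstoD(2)[OF 2(5) e(1)] order_tendstoD(1)[OF 2(4) e(2)] eventually_N_pos
    proof eventually_elim
      case (elim z)
      then have "g z / N z powr \<gamma> < h z / N z powr \<gamma>" by linarith
      with elim show ?case by (simp add: divide_less_cancel)
    qed
    then show ?thesis using assms(2) by (rule zero_or_power_cong)
  next
    case 3
    have *: "min x y / N z powr \<gamma> = min (x / N z powr \<gamma>) (y / N z powr \<gamma>)" for x y z
      by (cases "N z = 0") (auto simp: min_def divide_le_cancel)
    have "((\<lambda>z. min (h z) (g z) / N z powr \<gamma>) \<longlongrightarrow> min c d) F"
      using tendsto_min[OF 2(4,5)] by (simp add: *)
    then show ?thesis by (rule zero_or_power_limit) (use 2 3 in auto)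
  qed
qed

lemma zero_or_power_sum:
  assumes "finite A" "\<And>i. i \<in> A \<Longrightarrow> zero_or_power F N (h i)"
  shows "zero_or_power F N (\<lambda>z. \<Sum>i\<in>A. h i z)"
  using assms by (induction rule: finite_induct) (auto intro: zero_or_power_add zero_or_power_const)

lemma zero_or_power_Max:
  assumes "finite A" "A \<noteq> {}" "\<And>i. i \<in> A \<Longrightarrow> zero_or_power F N (h i)"
  shows "zero_or_power F N (\<lambda>z. Max ((\<lambda>i. h i z) ` A))"
  using assms
  by (induction rule: finite_ne_induct) (auto intro: zero_or_power_max)

lemma zero_or_power_Min:
  assumes "finite A" "A \<noteq> {}" "\<And>i. i \<in> A \<Longrightarrow> zero_or_power F N (h i)"
  shows "zero_or_power F N (\<lambda>z. Min ((\<lambda>i. h i z) ` A))"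
  using assms
  by (induction rule: finite_ne_induct) (auto intro: zero_or_power_min)

end

section \<open>Asymptotically polynomial functions\<close>

definition index_in :: "nat set \<Rightarrow> nat \<Rightarrow> nat" where
  "index_in I j = card {i \<in> I. i < j}"

text \<open>The vector of coordinates in \<open>I\<close>, in increasing order: the argument at
  which the \<open>I\<close>-specialisation must be evaluated to recover the value at
  \<open>x\<close> when \<open>x\<close> vanishes outside \<open>I\<close>.\<close>

definition compress :: "nat set \<Rightarrow> 'a list \<Rightarrow> 'a list" where
  "compress I x = map (\<lambda>r. x ! inv_into I (index_in I) r) [0..<card I]"

lemma bij_betw_index_in:
  assumes "finite I"
  shows "bij_betw (index_in I) I {..<card I}"
proof -
  have less: "index_in I i < index_in I j" if "i \<in> I" "i < j" for i j
    unfolding index_in_def using assms that by (intro psubset_card_mono) auto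
  have "inj_on (index_in I) I"
    by (intro linorder_inj_onI) (use less in fastforce)+
  moreover have "index_in I ` I \<subseteq> {..<card I}"
    using assms by (auto simp: index_in_def intro!: psubset_card_mono)
  ultimately show ?thesis
    by (simp add: bij_betw_def card_image card_subset_eq)
qed

lemma inv_into_index_in:
  assumes "finite I" "r < card I"
  shows "inv_into I (index_in I) r \<in> I"
  using bij_betw_index_in[OF assms(1)] assms(2) by (metis bij_betw_def inv_into_into lessThan_iff)

lemma nth_compress: "r < card I \<Longrightarrow> compress I x ! r = x ! inv_into I (index_in I) r"
  by (simp add: compress_def)

lemma compress_in_pos_vecs:
  assumes "finite I" "\<And>i. i \<in> I \<Longrightarrow> x ! i > 0"
  shows "compress I x \<in> pos_vecs (card I)"
  using assms by (auto simp: pos_vecs_def compress_def inv_into_index_in)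

lemma specialisation_compress:
  assumes "I \<subseteq> {..<length x}" "\<And>i. i < length x \<Longrightarrow> i \<notin> I \<Longrightarrow> x ! i = 0"
  shows "specialisation (length x) I f (compress I x) = f x"
proof -
  have fin: "finite I" using assms(1) finite_subset by blast
  have "compress I x ! index_in I j = x ! j" if "j \<in> I" for j
    using bij_betw_index_in[OF fin] that
    by (subst nth_compress) (auto simp: bij_betw_def inv_into_f_f)
  then have "map (\<lambda>j. if j \<in> I then compress I x ! index_in I j else 0) [0..<length x] = x"
    using assms by (intro nth_equalityI) auto
  then show ?thesis unfolding specialisation_def index_in_def by simp
qed

text \<open>A larger exponent in the normalisation would force the limit 0. This identifies the
  growth laws read off from different subsequences of one sequence.\<close>

lemma exponent_unique:
  fixes N :: "'a \<Rightarrow> real" and \<gamma> \<delta> c d :: real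
  assumes "filterlim N at_top F" "F \<noteq> bot"
    and "((\<lambda>z. h z / N z powr \<gamma>) \<longlongrightarrow> c) F" "((\<lambda>z. h z / N z powr \<delta>) \<longlongrightarrow> d) F" "c > 0" "d > 0"
  shows "\<gamma> = \<delta>" "c = d"
proof -
  show "\<gamma> = \<delta>"
  proof (rule ccontr)
    assume "\<gamma> \<noteq> \<delta>"
    then consider "\<gamma> < \<delta>" | "\<delta> < \<gamma>" by linarith
    then show False
    proof cases
      case 1
      then show False
        using tendsto_zero_higher_power[OF assms(1,3)] tendsto_unique[OF assms(2) _ assms(4)] assms(6)
        by fastforce
    next
      case 2
      then show False
        using tendsto_zero_higher_power[OF assms(1,4)] tendsto_unique[OF assms(2) _ assms(3)] assms(5)
        by fastforce
    qed
  qed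
  then show "c = d" using tendsto_unique[OF assms(2,3)] assms(4) by blast
qed

text \<open>Otherwise some sequence, agreeing with the model sequence at infinitely many indices but not at
  infinitely many others, would violate asymptotic polynomiality.\<close>

lemma asymp_poly_pos_uniform:
  assumes f: "asymp_poly_pos m f" and c: "\<And>i. i < m \<Longrightarrow> c i > 0"
  obtains c' \<gamma>' where "c' > 0"
    "\<And>\<epsilon>. \<epsilon> > 0 \<Longrightarrow> \<exists>\<delta>>0. \<exists>K. \<forall>k\<ge>K. \<forall>a\<in>pos_vecs m.
       (\<forall>i<m. \<bar>a ! i / real k powr \<gamma> i - c i\<bar> < \<delta>) \<longrightarrow> \<bar>f a / real k powr \<gamma>' - c'\<bar> < \<epsilon>"
proof -
  \<comment> \<open>The exact power sequence is the model. Its entry at \<open>k = 0\<close> is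
    adjusted since \<open>0 powr x\<close> is 0, while all members of an admissible sequence must be
    positive.\<close>
  define a\<^sub>0 where "a\<^sub>0 k = map (\<lambda>i. c i * (if k = 0 then 1 else real k powr \<gamma> i)) [0..<m]" for k :: nat
  have a0_pos: "a\<^sub>0 k \<in> pos_vecs m" for k
    using c by (auto simp: a\<^sub>0_def pos_vecs_def)
  have a0_nth: "a\<^sub>0 k ! i / real k powr \<gamma> i = c i" if "i < m" "k > 0" for i k
    using that by (simp add: a\<^sub>0_def)
  have "poly_growth (\<lambda>k. a\<^sub>0 k ! i) (c i) (\<gamma> i)" if "i < m" for i
    unfolding poly_growth_def using that
    by (intro tendsto_eventually eventually_sequentiallyI[of 1]) (simp add: a0_nth)
  then obtain c' \<gamma>' where c': "c' > 0" and lim0: "poly_growth (\<lambda>k. f (a\<^sub>0 k)) c' \<gamma>'"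
    using f c a0_pos unfolding asymp_poly_pos_def by blast
  show thesis
  proof (rule that[OF c'], rule ccontr)
    fix \<epsilon> :: real
    assume \<epsilon>: "\<epsilon> > 0" and contra: "\<not> (\<exists>\<delta>>0. \<exists>K. \<forall>k\<ge>K. \<forall>a\<in>pos_vecs m.
       (\<forall>i<m. \<bar>a ! i / real k powr \<gamma> i - c i\<bar> < \<delta>) \<longrightarrow> \<bar>f a / real k powr \<gamma>' - c'\<bar> < \<epsilon>)"
    define bad where "bad j k a \<longleftrightarrow> a \<in> pos_vecs m \<and>
       (\<forall>i<m. \<bar>a ! i / real k powr \<gamma> i - c i\<bar> < inverse (real (Suc j))) \<and>
       \<not> \<bar>f a / real k powr \<gamma>' - c'\<bar> < \<epsilon>" for j k a
    have ex: "\<exists>k\<ge>K. \<exists>a. bad j k a" for j K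
    proof -
      have "inverse (real (Suc j)) > 0" by simp
      then show ?thesis using contra unfolding bad_def by blast
    qed
    \<comment> \<open>A gap of at least 2 keeps each \<open>Suc (\<kappa> j)\<close> outside the
      range of \<open>\<kappa>\<close>, so the spliced sequence below returns to the model
      infinitely often.\<close>
    obtain g where g: "\<And>j. bad j (fst (g j)) (snd (g j))"
      and gap: "\<And>j. fst (g (Suc j)) \<ge> fst (g j) + 2"
    proof -
      have "\<exists>g. \<forall>j. bad j (fst (g j)) (snd (g j)) \<and> fst (g (Suc j)) \<ge> fst (g j) + 2"
      proof (rule dependent_nat_choice)
        show "\<exists>x. bad 0 (fst x) (snd x)" using ex[of 0 0] by auto
      next
        fix x j
        show "\<exists>y. bad (Suc j) (fst y) (snd y) \<and> fst x + 2 \<le> fst y"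
          using ex[of "fst x + 2" "Suc j"] by auto
      qed
      then show thesis using that by blast
    qed
    define \<kappa> where "\<kappa> j = fst (g j)" for j
    have mono: "strict_mono \<kappa>"
      unfolding strict_mono_Suc_iff \<kappa>_def
    proof
      show "fst (g j) < fst (g (Suc j))" for j using gap[of j] by simp
    qed
    then have inj: "inj \<kappa>" by (rule strict_mono_imp_inj_on)
    have succ: "Suc (\<kappa> j) \<notin> range \<kappa>" for j
    proof
      assume "Suc (\<kappa> j) \<in> range \<kappa>"
      then obtain i where i: "Suc (\<kappa> j) = \<kappa> i" by auto
      then have "j < i" using mono by (metis lessI strict_mono_less)
      then have "\<kappa> (Suc j) \<le> \<kappa> i" using mono by (simp add: strict_mono_less_eq)
      then show False using gap[of j] i by (simp add: \<kappa>_def)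
    qed
    \<comment> \<open>The tolerance \<open>inverse (Suc j)\<close> at the \<open>j\<close>-th bad
      index shrinks, so inserting the bad vectors into the model does not change the asymptotics of
      the coordinates, and the hypothesis applies to \<open>b\<close>.\<close>
    define b where "b k = (if k \<in> range \<kappa> then snd (g (inv \<kappa> k)) else a\<^sub>0 k)" for k
    have b_kappa: "b (\<kappa> j) = snd (g j)" for j using inj by (simp add: b_def)
    have b_pos: "b k \<in> pos_vecs m" for k using g a0_pos by (simp add: b_def bad_def)
    have "poly_growth (\<lambda>k. b k ! i) (c i) (\<gamma> i)" if i: "i < m" for i
      unfolding poly_growth_def LIMSEQ_iff
    proof (intro allI impI)
      fix e :: real assume e: "e > 0"
      then obtain j where j: "inverse (real (Suc j)) < e" using reals_Archimedean by blast
      have "norm (b k ! i / real k powr \<gamma> i - c i) < e" if k: "k \<ge> Suc (\<kappa> j)" for k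
      proof (cases "k \<in> range \<kappa>")
        case True
        then obtain l where l: "k = \<kappa> l" by auto
        then have "j < l" using k mono by (metis Suc_le_lessD strict_mono_less)
        then have "inverse (real (Suc l)) \<le> inverse (real (Suc j))" by (intro le_imp_inverse_le) auto
        moreover have "\<bar>b k ! i / real k powr \<gamma> i - c i\<bar> < inverse (real (Suc l))"
          using g[of l] i unfolding l b_kappa bad_def by (simp add: \<kappa>_def)
        ultimately show ?thesis using j unfolding real_norm_def by linarith
      next
        case False
        then show ?thesis using a0_nth[OF i, of k] k e by (simp add: b_def)
      qed
      then show "\<exists>k0. \<forall>k\<ge>k0. norm (b k ! i / real k powr \<gamma> i - c i) < e" by blast
    qed
    then obtain d \<delta> where d: "d > 0" and lim: "poly_growth (\<lambda>k. f (b k)) d \<delta>"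
      using f c b_pos unfolding asymp_poly_pos_def by blast
    have sub: "filterlim (\<lambda>j. Suc (\<kappa> j)) sequentially sequentially"
      using filterlim_subseq[OF mono] by (simp add: filterlim_Suc filterlim_compose[OF filterlim_Suc])
    \<comment> \<open>On the successors \<open>b\<close> is the model, so uniqueness of exponent and
      constant forces the model's growth law on all of \<open>b\<close>. At the indices
      \<open>\<kappa> j\<close> this contradicts badness.\<close>
    have "(\<lambda>j. f (a\<^sub>0 (Suc (\<kappa> j))) / real (Suc (\<kappa> j)) powr \<delta>) \<longlonglongrightarrow> d"
      using filterlim_compose[OF lim[unfolded poly_growth_def] sub] succ by (simp add: b_def)
    moreover have "(\<lambda>j. f (a\<^sub>0 (Suc (\<kappa> j))) / real (Suc (\<kappa> j)) powr \<gamma>') \<longlonglongrightarrow> c'"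
      using filterlim_compose[OF lim0[unfolded poly_growth_def] sub] .
    moreover have "filterlim (\<lambda>j. real (Suc (\<kappa> j))) at_top sequentially"
      by (rule filterlim_compose[OF filterlim_real_sequentially sub])
    ultimately have eq: "\<delta> = \<gamma>'" "d = c'"
      using exponent_unique[of "\<lambda>j. real (Suc (\<kappa> j))" sequentially] d c' by (auto simp del: of_nat_Suc)
    have "(\<lambda>j. f (b (\<kappa> j)) / real (\<kappa> j) powr \<gamma>') \<longlonglongrightarrow> c'"
      using filterlim_compose[OF lim[unfolded poly_growth_def] filterlim_subseq[OF mono]] eq by simp
    then obtain j where "\<bar>f (b (\<kappa> j)) / real (\<kappa> j) powr \<gamma>' - c'\<bar> < \<epsilon>"
      using \<epsilon> unfolding LIMSEQ_iff by fastforce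
    then show False using g[of j] unfolding bad_def b_kappa by (simp add: \<kappa>_def)
  qed
qed

text \<open>The uniform form of asymptotic polynomiality is applied at \<open>k = n z\<close>, which
  replaces sequences by an arbitrary filter.\<close>

lemma zero_or_power_fun:
  fixes n :: "'a \<Rightarrow> nat"
  assumes N: "filterlim (\<lambda>z. real (n z)) at_top F"
    and f: "asymp_poly (length hs) f" "\<forall>x\<in>nonneg_vecs (length hs). f x \<ge> 0"
    and hs: "\<And>h. h \<in> set hs \<Longrightarrow> zero_or_power F (\<lambda>z. real (n z)) h"
  shows "zero_or_power F (\<lambda>z. real (n z)) (\<lambda>z. f (map (\<lambda>h. h z) hs))"
proof -
  define m where "m = length hs"
  define x where "x z = map (\<lambda>h. h z) hs" for z
  \<comment> \<open>By the dichotomy a coordinate that is not eventually 0 is eventually positive.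
    Hence \<open>I\<close> is eventually the exact support of \<open>x z\<close>, and a single
    specialisation computes the value.\<close>
  define I where "I = {i. i < m \<and> \<not> (\<forall>\<^sub>F z in F. (hs ! i) z = 0)}"
  have I: "I \<subseteq> {..<m}" "finite I" by (auto simp: I_def)
  have len: "length (x z) = m" for z by (simp add: x_def m_def)
  have x_nth: "x z ! i = (hs ! i) z" if "i < m" for i z using that by (simp add: x_def m_def)
  have "\<forall>\<^sub>F z in F. \<forall>i\<in>{..<m} - I. x z ! i = 0"
    by (rule eventually_ball_finite) (auto simp: I_def x_nth)
  then have ev0: "\<forall>\<^sub>F z in F. \<forall>i<m. i \<notin> I \<longrightarrow> x z ! i = 0" by eventually_elim auto
  have "\<forall>\<^sub>F z in F. \<forall>i\<in>I. x z ! i > 0"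
  proof (rule eventually_ball_finite[OF I(2)], rule ballI)
    fix i assume i: "i \<in> I"
    then show "\<forall>\<^sub>F z in F. x z ! i > 0"
      using zero_or_power_pos[OF N hs[of "hs ! i"]] by (auto simp: I_def x_nth m_def)
  qed
  then have pos: "\<forall>\<^sub>F z in F. compress I (x z) \<in> pos_vecs (card I)"
    by eventually_elim (auto intro: compress_in_pos_vecs I)
  have f_eq: "\<forall>\<^sub>F z in F. f (x z) = specialisation m I f (compress I (x z))"
    using ev0
  proof eventually_elim
    case (elim z)
    then show ?case using specialisation_compress[of I "x z" f] I by (simp add: len)
  qed
  show ?thesis
  proof (cases "I = {}")
    \<comment> \<open>Specialisations have nonempty index sets, so none describes the zero vector;
      the value there is simply some nonnegative constant.\<close>
    case True
    have "\<forall>\<^sub>F z in F. f (x z) = f (replicate m 0)"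
      using ev0
    proof eventually_elim
      case (elim z)
      then have "x z = replicate m 0" using True by (intro nth_equalityI) (auto simp: len)
      then show ?case by simp
    qed
    moreover have "f (replicate m 0) \<ge> 0" using f(2) by (auto simp: nonneg_vecs_def m_def)
    ultimately show ?thesis
      unfolding x_def by (rule zero_or_power_cong[OF _ zero_or_power_const[OF N]])
  next
    case False
    consider "asymp_poly_pos (card I) (specialisation m I f)"
      | "\<forall>y\<in>pos_vecs (card I). specialisation m I f y = 0"
      using f(1) False I(1) unfolding asymp_poly_def m_def by blast
    then show ?thesis
    proof cases
      case 1
      have "\<exists>c \<gamma>. c > 0 \<and> ((\<lambda>z. x z ! i / real (n z) powr \<gamma>) \<longlongrightarrow> c) F" if "i \<in> I" for i
        using hs[of "hs ! i"] that unfolding zero_or_power_def by (auto simp: I_def x_nth m_def)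
      then obtain c \<gamma> where c: "\<And>i. i \<in> I \<Longrightarrow> c i > 0"
        and lim: "\<And>i. i \<in> I \<Longrightarrow> ((\<lambda>z. x z ! i / real (n z) powr \<gamma> i) \<longlongrightarrow> c i) F"
        by metis
      let ?i = "inv_into I (index_in I)"
      obtain c' \<gamma>' where c': "c' > 0" and unif:
        "\<And>\<epsilon>. \<epsilon> > 0 \<Longrightarrow> \<exists>\<delta>>0. \<exists>K. \<forall>k\<ge>K. \<forall>a\<in>pos_vecs (card I).
           (\<forall>r<card I. \<bar>a ! r / real k powr \<gamma> (?i r) - c (?i r)\<bar> < \<delta>) \<longrightarrow>
           \<bar>specialisation m I f a / real k powr \<gamma>' - c'\<bar> < \<epsilon>"
        using asymp_poly_pos_uniform[OF 1, of "\<lambda>r. c (?i r)" "\<lambda>r. \<gamma> (?i r)"] c inv_into_index_in[OF I(2)] by metis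
      have "((\<lambda>z. f (x z) / real (n z) powr \<gamma>') \<longlongrightarrow> c') F"
        unfolding tendsto_iff dist_real_def
      proof (intro allI impI)
        fix \<epsilon> :: real assume "\<epsilon> > 0"
        from unif[OF this] obtain \<delta> K where \<delta>: "\<delta> > 0" and K:
          "\<And>k a. k \<ge> K \<Longrightarrow> a \<in> pos_vecs (card I) \<Longrightarrow>
             \<forall>r<card I. \<bar>a ! r / real k powr \<gamma> (?i r) - c (?i r)\<bar> < \<delta> \<Longrightarrow>
             \<bar>specialisation m I f a / real k powr \<gamma>' - c'\<bar> < \<epsilon>" by blast
        have "\<forall>\<^sub>F z in F. \<forall>i\<in>I. \<bar>x z ! i / real (n z) powr \<gamma> i - c i\<bar> < \<delta>"
          by (rule eventually_ball_finite[OF I(2)])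
             (use tendstoD[OF lim \<delta>] in \<open>auto simp: dist_real_def\<close>)
        moreover have "\<forall>\<^sub>F z in F. n z \<ge> K"
          using N[unfolded filterlim_at_top, rule_format, of "real K"] by simp
        ultimately show "\<forall>\<^sub>F z in F. \<bar>f (x z) / real (n z) powr \<gamma>' - c'\<bar> < \<epsilon>"
          using f_eq pos
        proof eventually_elim
          case (elim z)
          then show ?case using K[of "n z" "compress I (x z)"] inv_into_index_in[OF I(2)]
            by (simp add: nth_compress)
        qed
      qed
      then show ?thesis using c' unfolding x_def by (rule zero_or_power_limit)
    next
      case 2
      have "\<forall>\<^sub>F z in F. f (x z) = 0"
        using f_eq pos by eventually_elim (use 2 in auto)
      then show ?thesis unfolding x_def by (rule zero_or_power_zero)
    qed
  qed
qed

section \<open>Types of vertex tuples in quasirandom graphs\<close>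

text \<open>The quantifier-free type of model theory. As a pair of relations on \<open>V\<close>, it
  restricts to fewer variables by intersection.\<close>

definition type_of :: "nat set \<Rightarrow> 'v ugraph \<Rightarrow> (nat \<Rightarrow> 'v) \<Rightarrow> (nat \<times> nat) set \<times> (nat \<times> nat) set" where
  "type_of V G \<sigma> = ({(x, y) \<in> V \<times> V. \<sigma> x = \<sigma> y}, {(x, y) \<in> V \<times> V. {\<sigma> x, \<sigma> y} \<in> snd G})"

definition extensions :: "'v ugraph \<Rightarrow> 'v set \<Rightarrow> 'v set \<Rightarrow> 'v set" where
  "extensions G A B = {a \<in> fst G - (A \<union> B). (\<forall>x\<in>A. {x, a} \<in> snd G) \<and> (\<forall>x\<in>B. {x, a} \<notin> snd G)}"

text \<open>A loop at a new vertex would be part of its type without being controlled by \<open>A\<close> and \<open>B\<close>;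
  hence the condition on singletons.\<close>

definition quasirandom :: "real \<Rightarrow> nat \<Rightarrow> 'v ugraph \<Rightarrow> bool" where
  "quasirandom p m G \<longleftrightarrow> finite (fst G) \<and> m \<le> card (fst G) \<and> (\<forall>a. {a} \<notin> snd G) \<and>
     (\<forall>A B. A \<subseteq> fst G \<longrightarrow> B \<subseteq> fst G \<longrightarrow> A \<inter> B = {} \<longrightarrow> card A \<le> m \<longrightarrow> card B \<le> m \<longrightarrow>
        \<bar>card (extensions G A B) / card (fst G) - p ^ card A * (1 - p) ^ card B\<bar> \<le> inverse (Suc m))"

text \<open>A property holds eventually if one \<open>m\<close> guarantees it for all
  \<open>m\<close>-quasirandom graphs and all tuples of type \<open>T\<close> at once. The single
  parameter bounds the size of patterns, the error and the number of vertices, so the sets decrease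
  in \<open>m\<close> and form a filter base.\<close>

definition type_filter ::
  "real \<Rightarrow> nat set \<Rightarrow> (nat \<times> nat) set \<times> (nat \<times> nat) set \<Rightarrow> ('v ugraph \<times> (nat \<Rightarrow> 'v)) filter" where
  "type_filter p V T =
     (INF m. principal {(G, \<sigma>). quasirandom p m G \<and> \<sigma> ` V \<subseteq> fst G \<and> type_of V G \<sigma> = T})"

abbreviation num_vertices :: "'v ugraph \<times> (nat \<Rightarrow> 'v) \<Rightarrow> real" where
  "num_vertices z \<equiv> real (card (fst (fst z)))"

lemma quasirandom_antimono: "quasirandom p m' G \<Longrightarrow> m \<le> m' \<Longrightarrow> quasirandom p m G"
proof -
  assume *: "quasirandom p m' G" "m \<le> m'"
  have "inverse (real (Suc m')) \<le> inverse (real (Suc m))"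
    using *(2) by (intro le_imp_inverse_le) auto
  then show ?thesis
    using * unfolding quasirandom_def by (meson order_trans)
qed

lemma eventually_type_filter:
  "eventually P (type_filter p V T) \<longleftrightarrow>
     (\<exists>m. \<forall>G \<sigma>. quasirandom p m G \<longrightarrow> \<sigma> ` V \<subseteq> fst G \<longrightarrow> type_of V G \<sigma> = T \<longrightarrow> P (G, \<sigma>))"
  unfolding type_filter_def
proof (subst eventually_INF_base)
  fix m m' :: nat
  show "\<exists>x\<in>UNIV. principal {(G, \<sigma>). quasirandom p x G \<and> \<sigma> ` V \<subseteq> fst G \<and> type_of V G \<sigma> = T}
    \<le> inf (principal {(G, \<sigma>). quasirandom p m G \<and> \<sigma> ` V \<subseteq> fst G \<and> type_of V G \<sigma> = T})
          (principal {(G, \<sigma>). quasirandom p m' G \<and> \<sigma> ` V \<subseteq> fst G \<and> type_of V G \<sigma> = T})"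
    by (rule bexI[of _ "max m m'"]) (auto intro: quasirandom_antimono)
qed (auto simp: eventually_principal)

lemma eventually_type_filterI:
  assumes "\<And>G \<sigma>. quasirandom p m G \<Longrightarrow> \<sigma> ` V \<subseteq> fst G \<Longrightarrow> type_of V G \<sigma> = T \<Longrightarrow> P (G, \<sigma>)"
  shows "eventually P (type_filter p V T)"
  using assms unfolding eventually_type_filter by blast

lemma num_vertices_at_top: "filterlim num_vertices at_top (type_filter p V T)"
  unfolding filterlim_at_top
proof
  fix Z :: real
  obtain m where m: "Z \<le> real m" using real_arch_simple by blast
  show "\<forall>\<^sub>F z in type_filter p V T. Z \<le> num_vertices z"
    by (rule eventually_type_filterI[of _ m]) (use m in \<open>auto simp: quasirandom_def\<close>)
qed

text \<open>Forgetting variables. A bound variable may also occur in \<open>V\<close>; aggregators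
  are then analysed over \<open>V - {v}\<close> and the result is carried back to
  \<open>V\<close>.\<close>

lemma type_filter_mono:
  assumes "V\<^sub>0 \<subseteq> V"
  shows "type_filter p V T \<le> type_filter p V\<^sub>0 (fst T \<inter> V\<^sub>0 \<times> V\<^sub>0, snd T \<inter> V\<^sub>0 \<times> V\<^sub>0)"
proof (rule filter_leI)
  fix P
  have *: "\<sigma> ` V\<^sub>0 \<subseteq> fst G"
    "type_of V\<^sub>0 G \<sigma> = (fst T \<inter> V\<^sub>0 \<times> V\<^sub>0, snd T \<inter> V\<^sub>0 \<times> V\<^sub>0)"
    if "\<sigma> ` V \<subseteq> fst G" "type_of V G \<sigma> = T" for G \<sigma>
    using that assms by (auto simp: type_of_def)
  assume "eventually P (type_filter p V\<^sub>0 (fst T \<inter> V\<^sub>0 \<times> V\<^sub>0, snd T \<inter> V\<^sub>0 \<times> V\<^sub>0))"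
  then obtain m where m: "\<And>G \<sigma>. quasirandom p m G \<Longrightarrow> \<sigma> ` V\<^sub>0 \<subseteq> fst G \<Longrightarrow>
     type_of V\<^sub>0 G \<sigma> = (fst T \<inter> V\<^sub>0 \<times> V\<^sub>0, snd T \<inter> V\<^sub>0 \<times> V\<^sub>0) \<Longrightarrow> P (G, \<sigma>)"
    unfolding eventually_type_filter by blast
  show "eventually P (type_filter p V T)"
    by (rule eventually_type_filterI[of _ m]) (use m * in blast)
qed

section \<open>One-vertex extensions of a type and their number\<close>

lemma type_of_eq_iff:
  "type_of V G \<sigma> = type_of V H \<rho> \<longleftrightarrow>
     (\<forall>x\<in>V. \<forall>y\<in>V. (\<sigma> x = \<sigma> y \<longleftrightarrow> \<rho> x = \<rho> y) \<and> ({\<sigma> x, \<sigma> y} \<in> snd G \<longleftrightarrow> {\<rho> x, \<rho> y} \<in> snd H))"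
  unfolding type_of_def by (simp add: set_eq_iff) blast

text \<open>Only the relations between the new vertex and \<open>V\<close> remain to be compared:
  the old pairs agree by hypothesis, and the pair of \<open>v\<close> with itself is settled by the
  absence of loops.\<close>

lemma type_of_insert_eq_iff:
  assumes "type_of V G \<sigma> = type_of V H \<rho>" "v \<notin> V" "{a} \<notin> snd G" "{b} \<notin> snd H"
  shows "type_of (insert v V) G (\<sigma>(v := a)) = type_of (insert v V) H (\<rho>(v := b)) \<longleftrightarrow>
     (\<forall>x\<in>V. (\<sigma> x = a \<longleftrightarrow> \<rho> x = b) \<and> ({\<sigma> x, a} \<in> snd G \<longleftrightarrow> {\<rho> x, b} \<in> snd H))" (is "?l \<longleftrightarrow> ?r")
proof
  assume ?l
  show ?r
  proof
    fix x assume x: "x \<in> V"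
    then have "x \<noteq> v" using assms(2) by auto
    moreover have "((\<sigma>(v := a)) x = (\<sigma>(v := a)) v \<longleftrightarrow> (\<rho>(v := b)) x = (\<rho>(v := b)) v) \<and>
       ({(\<sigma>(v := a)) x, (\<sigma>(v := a)) v} \<in> snd G \<longleftrightarrow> {(\<rho>(v := b)) x, (\<rho>(v := b)) v} \<in> snd H)"
      using \<open>?l\<close>[unfolded type_of_eq_iff] x by blast
    ultimately show "(\<sigma> x = a \<longleftrightarrow> \<rho> x = b) \<and> ({\<sigma> x, a} \<in> snd G \<longleftrightarrow> {\<rho> x, b} \<in> snd H)" by simp
  qed
next
  assume r: ?r
  have flip: "(a = \<sigma> x) = (\<sigma> x = a)" "(b = \<rho> x) = (\<rho> x = b)"
    "{a, \<sigma> x} = {\<sigma> x, a}" "{b, \<rho> x} = {\<rho> x, b}" for x by auto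
  show ?l
    unfolding type_of_eq_iff
  proof (intro ballI)
    fix x y assume "x \<in> insert v V" "y \<in> insert v V"
    then show "((\<sigma>(v := a)) x = (\<sigma>(v := a)) y \<longleftrightarrow> (\<rho>(v := b)) x = (\<rho>(v := b)) y) \<and>
       ({(\<sigma>(v := a)) x, (\<sigma>(v := a)) y} \<in> snd G \<longleftrightarrow> {(\<rho>(v := b)) x, (\<rho>(v := b)) y} \<in> snd H)"
      using r assms(1)[unfolded type_of_eq_iff] assms(2-4) by (auto simp: flip)
  qed
qed

definition typed_extensions ::
  "'v ugraph \<Rightarrow> (nat \<Rightarrow> 'v) \<Rightarrow> nat set \<Rightarrow> nat \<Rightarrow> (nat \<times> nat) set \<times> (nat \<times> nat) set \<Rightarrow> 'v set" where
  "typed_extensions G \<sigma> V v T' = {a \<in> fst G. type_of (insert v V) G (\<sigma>(v := a)) = T'}"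

text \<open>The number of distinct vertices named by a set of variables is read off from the
  equality pattern, so it is the same for all tuples of one type.\<close>

lemma card_image_eq_pattern:
  assumes "\<And>x y. x \<in> A \<Longrightarrow> y \<in> A \<Longrightarrow> f x = f y \<longleftrightarrow> g x = g y"
  shows "card (f ` A) = card (g ` A)"
proof -
  have "bij_betw (\<lambda>z. g (inv_into A f z)) (f ` A) (g ` A)"
    unfolding bij_betw_def
  proof
    show "inj_on (\<lambda>z. g (inv_into A f z)) (f ` A)"
      using assms by (intro inj_onI) (metis f_inv_into_f inv_into_into)
    show "(\<lambda>z. g (inv_into A f z)) ` f ` A = g ` A"
    proof -
      have "g (inv_into A f (f x)) = g x" if "x \<in> A" for x
        using assms that by (metis f_inv_into_f imageI inv_into_into)
      then show ?thesis by (simp add: image_image)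
    qed
  qed
  then show ?thesis by (rule bij_betw_same_card)
qed

text \<open>If no loop-free graph extends \<open>T\<close> to \<open>T'\<close>, the count is 0. If
  the new vertex coincides with an old one in some extension, it does so in all, and the count is 1.
  Otherwise the extensions are those of an adjacency pattern controlled by
  \<open>quasirandom\<close>.\<close>

lemma zero_or_power_card_typed_extensions:
  fixes T T' :: "(nat \<times> nat) set \<times> (nat \<times> nat) set"
  assumes p: "0 < p" "p < 1" and V: "finite V" "v \<notin> V"
  shows "zero_or_power (type_filter p V T) num_vertices
           (\<lambda>z :: 'v ugraph \<times> (nat \<Rightarrow> 'v). real (card (typed_extensions (fst z) (snd z) V v T')))"
proof (cases "\<forall>(G :: 'v ugraph) \<sigma>. (\<forall>a. {a} \<notin> snd G) \<longrightarrow> type_of V G \<sigma> = T \<longrightarrow> typed_extensions G \<sigma> V v T' = {}")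
  case True
  show ?thesis
  proof (rule zero_or_power_zero, rule eventually_type_filterI[of _ 0])
    fix G :: "'v ugraph" and \<sigma>
    assume "quasirandom p 0 G" "type_of V G \<sigma> = T"
    then have "typed_extensions G \<sigma> V v T' = {}" using True unfolding quasirandom_def by blast
    then show "real (card (typed_extensions (fst (G, \<sigma>)) (snd (G, \<sigma>)) V v T')) = 0" by simp
  qed
next
  case False
  \<comment> \<open>\<open>H\<close> is just some loop-free graph, possibly far from quasirandom; it
    is a template showing how a vertex of type \<open>T'\<close> relates to
    \<open>V\<close>.\<close>
  then obtain H :: "'v ugraph" and \<rho> where H: "\<And>a. {a} \<notin> snd H" "type_of V H \<rho> = T"
    and "typed_extensions H \<rho> V v T' \<noteq> {}"
    by blast
  then obtain b where b: "type_of (insert v V) H (\<rho>(v := b)) = T'"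
    unfolding typed_extensions_def by blast
  have ext: "typed_extensions G \<sigma> V v T' =
      {a \<in> fst G. \<forall>x\<in>V. (\<sigma> x = a \<longleftrightarrow> \<rho> x = b) \<and> ({\<sigma> x, a} \<in> snd G \<longleftrightarrow> {\<rho> x, b} \<in> snd H)}"
    if "quasirandom p m G" "type_of V G \<sigma> = T" for G \<sigma> m
  proof -
    have "{a} \<notin> snd G" for a using that(1) by (simp add: quasirandom_def)
    then show ?thesis
      using type_of_insert_eq_iff[of V G \<sigma> H \<rho> v _ b] that(2) H V(2) b
      unfolding typed_extensions_def by auto
  qed
  show ?thesis
  proof (cases "b \<in> \<rho> ` V")
    case True
    then obtain x\<^sub>0 where x0: "x\<^sub>0 \<in> V" "b = \<rho> x\<^sub>0" by auto
    have "\<forall>\<^sub>F z :: 'v ugraph \<times> (nat \<Rightarrow> 'v) in type_filter p V T.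
        real (card (typed_extensions (fst z) (snd z) V v T')) = 1"
    proof (rule eventually_type_filterI[of _ 0])
      fix G :: "'v ugraph" and \<sigma>
      assume G: "quasirandom p 0 G" "\<sigma> ` V \<subseteq> fst G" "type_of V G \<sigma> = T"
      have "typed_extensions G \<sigma> V v T' = {\<sigma> x\<^sub>0}"
      proof -
        have "(\<sigma> x = \<sigma> x\<^sub>0 \<longleftrightarrow> \<rho> x = b) \<and> ({\<sigma> x, \<sigma> x\<^sub>0} \<in> snd G \<longleftrightarrow> {\<rho> x, b} \<in> snd H)"
          if "x \<in> V" for x
        proof -
          have "type_of V G \<sigma> = type_of V H \<rho>" using G(3) H(2) by simp
          from this[unfolded type_of_eq_iff, rule_format, OF that x0(1)] show ?thesis
            by (simp add: x0(2))
        qed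
        then show ?thesis using G(2) x0 unfolding ext[OF G(1,3)] by auto
      qed
      then show "real (card (typed_extensions (fst (G, \<sigma>)) (snd (G, \<sigma>)) V v T')) = 1" by simp
    qed
    then show ?thesis
      by (rule zero_or_power_cong) (simp add: zero_or_power_const[OF num_vertices_at_top])
  next
    case b_new: False
    define A where "A = {x \<in> V. {\<rho> x, b} \<in> snd H}"
    \<comment> \<open>The exponents count distinct vertices rather than variables, because several
      variables may name the same vertex.\<close>
    define q where "q = p ^ card (\<rho> ` A) * (1 - p) ^ card (\<rho> ` (V - A))"
    have AV: "A \<subseteq> V" by (auto simp: A_def)
    have "((\<lambda>z :: 'v ugraph \<times> (nat \<Rightarrow> 'v). real (card (typed_extensions (fst z) (snd z) V v T')) / num_vertices z powr 1) \<longlongrightarrow> q)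
            (type_filter p V T)"
      unfolding tendsto_iff
    proof (intro allI impI)
      fix \<epsilon> :: real assume "\<epsilon> > 0"
      then obtain m\<^sub>0 where m0: "inverse (real (Suc m\<^sub>0)) < \<epsilon>" using reals_Archimedean by blast
      \<comment> \<open>\<open>m\<^sub>0\<close> supplies the accuracy, and \<open>card V\<close>
        makes the two sides of the pattern small enough for \<open>quasirandom\<close> to cover
        them.\<close>
      define m where "m = max m\<^sub>0 (card V)"
      have "inverse (real (Suc m)) \<le> inverse (real (Suc m\<^sub>0))"
        by (intro le_imp_inverse_le) (auto simp: m_def)
      then have m: "inverse (real (Suc m)) < \<epsilon>" using m0 by linarith
      show "\<forall>\<^sub>F z :: 'v ugraph \<times> (nat \<Rightarrow> 'v) in type_filter p V T.
          dist (real (card (typed_extensions (fst z) (snd z) V v T')) / num_vertices z powr 1) q < \<epsilon>"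
      proof (rule eventually_type_filterI[of _ m])
        fix G :: "'v ugraph" and \<sigma>
        assume G: "quasirandom p m G" "\<sigma> ` V \<subseteq> fst G" "type_of V G \<sigma> = T"
        have T: "\<sigma> x = \<sigma> y \<longleftrightarrow> \<rho> x = \<rho> y" if "x \<in> V" "y \<in> V" for x y
        proof -
          have "type_of V G \<sigma> = type_of V H \<rho>" using G(3) H(2) by simp
          from this[unfolded type_of_eq_iff, rule_format, OF that] show ?thesis by simp
        qed
        have ext_eq: "typed_extensions G \<sigma> V v T' = extensions G (\<sigma> ` A) (\<sigma> ` (V - A))"
          unfolding ext[OF G(1,3)] extensions_def using b_new by (auto simp: A_def)
        have disj: "\<sigma> ` A \<inter> \<sigma> ` (V - A) = {}"
          using T AV by (fastforce simp: A_def)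
        have small: "card (\<sigma> ` A) \<le> m" "card (\<sigma> ` (V - A)) \<le> m"
        proof -
          have "card (\<sigma> ` B) \<le> m" if "B \<subseteq> V" for B
            using card_image_le[of B \<sigma>] card_mono[OF V(1) that] finite_subset[OF that V(1)]
            by (simp add: m_def)
          then show "card (\<sigma> ` A) \<le> m" "card (\<sigma> ` (V - A)) \<le> m" using AV by auto
        qed
        have cards: "card (\<sigma> ` A) = card (\<rho> ` A)" "card (\<sigma> ` (V - A)) = card (\<rho> ` (V - A))"
          by (intro card_image_eq_pattern T; use AV in blast)+
        have "\<bar>card (typed_extensions G \<sigma> V v T') / card (fst G) - q\<bar> \<le> inverse (real (Suc m))"
        proof -
          have "\<sigma> ` A \<subseteq> fst G" "\<sigma> ` (V - A) \<subseteq> fst G" using G(2) AV by auto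
          with G(1) disj small
          have "\<bar>card (extensions G (\<sigma> ` A) (\<sigma> ` (V - A))) / card (fst G) -
              p ^ card (\<sigma> ` A) * (1 - p) ^ card (\<sigma> ` (V - A))\<bar> \<le> inverse (Suc m)"
            unfolding quasirandom_def by blast
          then show ?thesis unfolding ext_eq q_def cards .
        qed
        then show "dist (real (card (typed_extensions (fst (G, \<sigma>)) (snd (G, \<sigma>)) V v T')) / num_vertices (G, \<sigma>) powr 1) q < \<epsilon>"
          using m by (simp add: dist_real_def del: of_nat_Suc)
      qed
    qed
    moreover have "q > 0" using p by (simp add: q_def)
    ultimately show ?thesis by (rule zero_or_power_limit)
  qed
qed

text \<open>The \<open>m\<close> that witnesses the property does not depend on the tuple, so it
  serves all extensions of a tuple simultaneously.\<close>

lemma eventually_typed_extensions: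
  assumes "eventually P (type_filter p (insert v V) T')"
  shows "\<forall>\<^sub>F z in type_filter p V T.
           \<forall>a\<in>typed_extensions (fst z) (snd z) V v T'. P (fst z, (snd z)(v := a))"
proof -
  obtain m where m: "\<And>G \<sigma>. quasirandom p m G \<Longrightarrow> \<sigma> ` insert v V \<subseteq> fst G \<Longrightarrow>
      type_of (insert v V) G \<sigma> = T' \<Longrightarrow> P (G, \<sigma>)"
    using assms unfolding eventually_type_filter by blast
  show ?thesis
    by (rule eventually_type_filterI[of _ m], unfold typed_extensions_def, safe, rule m) auto
qed

text \<open>A squeeze: all values of \<open>h\<close> on extensions of one type share the same
  asymptotics, and \<open>s\<close> lies between two of them. Averages, maxima and minima over a
  type class are instances.\<close>

lemma zero_or_power_between:
  assumes h: "zero_or_power (type_filter p (insert v V) T') num_vertices h"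
    and s: "\<forall>\<^sub>F z in type_filter p V T. \<exists>a\<in>typed_extensions (fst z) (snd z) V v T'.
              \<exists>b\<in>typed_extensions (fst z) (snd z) V v T'.
                h (fst z, (snd z)(v := a)) \<le> s z \<and> s z \<le> h (fst z, (snd z)(v := b))"
  shows "zero_or_power (type_filter p V T) num_vertices s"
  using h
proof (cases rule: zero_or_power_cases)
  case zero
  have "\<forall>\<^sub>F z in type_filter p V T. s z = 0"
    using eventually_typed_extensions[OF zero] s by eventually_elim fastforce
  then show ?thesis by (rule zero_or_power_zero)
next
  case (power c \<gamma>)
  have "((\<lambda>z. s z / num_vertices z powr \<gamma>) \<longlongrightarrow> c) (type_filter p V T)"
    unfolding tendsto_iff
  proof (intro allI impI)
    fix \<epsilon> :: real assume "\<epsilon> > 0"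
    from tendstoD[OF power(2) this]
    have "\<forall>\<^sub>F z in type_filter p V T. \<forall>a\<in>typed_extensions (fst z) (snd z) V v T'.
        dist (h (fst z, (snd z)(v := a)) / num_vertices z powr \<gamma>) c < \<epsilon>"
      by (drule_tac eventually_typed_extensions) simp
    then show "\<forall>\<^sub>F z in type_filter p V T. dist (s z / num_vertices z powr \<gamma>) c < \<epsilon>"
      using s
    proof eventually_elim
      case (elim z)
      then obtain a b where ab: "a \<in> typed_extensions (fst z) (snd z) V v T'"
          "b \<in> typed_extensions (fst z) (snd z) V v T'"
        and le: "h (fst z, (snd z)(v := a)) \<le> s z" "s z \<le> h (fst z, (snd z)(v := b))" by blast
      have "h (fst z, (snd z)(v := a)) / num_vertices z powr \<gamma> \<le> s z / num_vertices z powr \<gamma>"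
        "s z / num_vertices z powr \<gamma> \<le> h (fst z, (snd z)(v := b)) / num_vertices z powr \<gamma>"
        using le by (auto intro: divide_right_mono)
      moreover have "dist (h (fst z, (snd z)(v := a)) / num_vertices z powr \<gamma>) c < \<epsilon>"
        "dist (h (fst z, (snd z)(v := b)) / num_vertices z powr \<gamma>) c < \<epsilon>"
        using elim(1) ab by blast+
      ultimately show ?case unfolding dist_real_def by linarith
    qed
  qed
  then show ?thesis using power(1) by (rule zero_or_power_limit)
qed

section \<open>Aggregation over one vertex variable\<close>

definition all_types :: "nat set \<Rightarrow> ((nat \<times> nat) set \<times> (nat \<times> nat) set) set" where
  "all_types V = Pow (V \<times> V) \<times> Pow (V \<times> V)"

lemma finite_all_types: "finite V \<Longrightarrow> finite (all_types V)"
  by (simp add: all_types_def)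

lemma type_of_in_all_types: "type_of V G \<sigma> \<in> all_types V"
  by (auto simp: all_types_def type_of_def)

lemma Max_image_UN:
  fixes g :: "'a \<Rightarrow> 'b :: linorder"
  assumes "finite R" "R \<noteq> {}" "\<And>i. i \<in> R \<Longrightarrow> finite (E i) \<and> E i \<noteq> {}"
  shows "Max (g ` (\<Union>i\<in>R. E i)) = Max ((\<lambda>i. Max (g ` E i)) ` R)"
  using assms by (induction rule: finite_ne_induct) (auto simp: image_Un Max_Un)

lemma Min_image_UN:
  fixes g :: "'a \<Rightarrow> 'b :: linorder"
  assumes "finite R" "R \<noteq> {}" "\<And>i. i \<in> R \<Longrightarrow> finite (E i) \<and> E i \<noteq> {}"
  shows "Min (g ` (\<Union>i\<in>R. E i)) = Min ((\<lambda>i. Min (g ` E i)) ` R)"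
  using assms by (induction rule: finite_ne_induct) (auto simp: image_Un Min_Un)

lemma eventually_finite: "\<forall>\<^sub>F z in type_filter p V T. finite (fst (fst z))"
  by (rule eventually_type_filterI[of _ 0]) (simp add: quasirandom_def)

context
  fixes p :: real and V :: "nat set" and v :: nat
    and h :: "'v ugraph \<times> (nat \<Rightarrow> 'v) \<Rightarrow> real"
  assumes p: "0 < p" "p < 1" and V: "finite V" "v \<notin> V"
    and h: "\<And>T'. zero_or_power (type_filter p (insert v V) T') num_vertices h"
begin

text \<open>The number of extensions is a zero-or-power function, so it cannot keep alternating
  between zero and nonzero.\<close>

lemma typed_extensions_cases:
  "((\<forall>\<^sub>F z :: 'v ugraph \<times> (nat \<Rightarrow> 'v) in type_filter p V T.
      finite (typed_extensions (fst z) (snd z) V v T') \<and> typed_extensions (fst z) (snd z) V v T' = {})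
   \<or> (\<forall>\<^sub>F z :: 'v ugraph \<times> (nat \<Rightarrow> 'v) in type_filter p V T.
      finite (typed_extensions (fst z) (snd z) V v T') \<and> typed_extensions (fst z) (snd z) V v T' \<noteq> {}))"
proof -
  have fin: "\<forall>\<^sub>F z :: 'v ugraph \<times> (nat \<Rightarrow> 'v) in type_filter p V T.
      finite (typed_extensions (fst z) (snd z) V v T')"
    using eventually_finite by eventually_elim (simp add: typed_extensions_def)
  from zero_or_power_pos[OF num_vertices_at_top zero_or_power_card_typed_extensions[OF p V, of T T']]
  show ?thesis
  proof (elim disjE)
    assume "\<forall>\<^sub>F z :: 'v ugraph \<times> (nat \<Rightarrow> 'v) in type_filter p V T.
        real (card (typed_extensions (fst z) (snd z) V v T')) = 0"
    then show ?thesis using fin by (intro disjI1, eventually_elim) auto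
  next
    assume "\<forall>\<^sub>F z :: 'v ugraph \<times> (nat \<Rightarrow> 'v) in type_filter p V T.
        real (card (typed_extensions (fst z) (snd z) V v T')) > 0"
    then show ?thesis using fin by (intro disjI2, eventually_elim) auto
  qed
qed

text \<open>The vertices are grouped by the type they produce. Each partial sum is the average over
  its class, handled by squeezing, times the size of the class.\<close>

lemma zero_or_power_sum_vertices:
  "zero_or_power (type_filter p V T) num_vertices (\<lambda>z. \<Sum>a\<in>fst (fst z). h (fst z, (snd z)(v := a)))"
proof -
  let ?E = "\<lambda>z :: 'v ugraph \<times> (nat \<Rightarrow> 'v). typed_extensions (fst z) (snd z) V v"
  let ?S = "\<lambda>T' z. \<Sum>a\<in>?E z T'. h (fst z, (snd z)(v := a))"
  have "zero_or_power (type_filter p V T) num_vertices (?S T')" for T'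
    using typed_extensions_cases[of T' T]
  proof
    assume ev: "\<forall>\<^sub>F z in type_filter p V T. finite (?E z T') \<and> ?E z T' = {}"
    show ?thesis
      by (rule zero_or_power_zero) (use ev in eventually_elim, simp)
  next
    assume ev: "\<forall>\<^sub>F z in type_filter p V T. finite (?E z T') \<and> ?E z T' \<noteq> {}"
    have "zero_or_power (type_filter p V T) num_vertices (\<lambda>z. ?S T' z / real (card (?E z T')))"
    proof (rule zero_or_power_between[OF h[of T']])
      show "\<forall>\<^sub>F z in type_filter p V T. \<exists>a\<in>?E z T'. \<exists>b\<in>?E z T'.
          h (fst z, (snd z)(v := a)) \<le> ?S T' z / real (card (?E z T')) \<and>
          ?S T' z / real (card (?E z T')) \<le> h (fst z, (snd z)(v := b))"
        using ev
      proof eventually_elim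
        case (elim z)
        let ?g = "\<lambda>a. h (fst z, (snd z)(v := a))"
        have pos: "card (?E z T') > 0" using elim by (simp add: card_gt_0_iff)
        have "Min (?g ` ?E z T') \<in> ?g ` ?E z T'" "Max (?g ` ?E z T') \<in> ?g ` ?E z T'"
          using elim by (auto intro: Min_in Max_in)
        then obtain a b where ab: "a \<in> ?E z T'" "b \<in> ?E z T'"
          "?g a = Min (?g ` ?E z T')" "?g b = Max (?g ` ?E z T')" by auto
        have "real (card (?E z T')) * ?g a \<le> ?S T' z"
          by (rule sum_bounded_below) (use elim ab in auto)
        moreover have "?S T' z \<le> real (card (?E z T')) * ?g b"
          by (rule sum_bounded_above) (use elim ab in auto)
        ultimately show ?case using ab(1,2) pos
          by (intro bexI[of _ a] bexI[of _ b]) (auto simp: field_simps)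
      qed
    qed
    from zero_or_power_mult[OF num_vertices_at_top this
        zero_or_power_card_typed_extensions[OF p V, of T T']]
    show ?thesis
      by (rule zero_or_power_cong[rotated]) (use ev in eventually_elim, auto)
  qed
  then have sum: "zero_or_power (type_filter p V T) num_vertices (\<lambda>z. \<Sum>T'\<in>all_types (insert v V). ?S T' z)"
    using V by (intro zero_or_power_sum num_vertices_at_top finite_all_types) auto
  have eq: "\<forall>\<^sub>F z in type_filter p V T. (\<Sum>a\<in>fst (fst z). h (fst z, (snd z)(v := a)))
      = (\<Sum>T'\<in>all_types (insert v V). ?S T' z)"
    using eventually_finite
  proof eventually_elim
    case (elim z)
    show ?case
      unfolding typed_extensions_def
      by (rule sum.group[symmetric]) (use elim V in \<open>auto simp: finite_all_types type_of_in_all_types\<close>)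
  qed
  show ?thesis by (rule zero_or_power_cong[OF eq sum])
qed

text \<open>An extremum over all vertices is the extremum of the extrema over type classes. Classes
  that are eventually empty are discarded first, since \<open>Max\<close> and \<open>Min\<close>
  carry no information on the empty set.\<close>

lemma zero_or_power_Max_Min_vertices:
  "zero_or_power (type_filter p V T) num_vertices (\<lambda>z. Max ((\<lambda>a. h (fst z, (snd z)(v := a))) ` fst (fst z)))"
  (is ?max)
  "zero_or_power (type_filter p V T) num_vertices (\<lambda>z. Min ((\<lambda>a. h (fst z, (snd z)(v := a))) ` fst (fst z)))"
  (is ?min)
proof -
  let ?E = "\<lambda>z :: 'v ugraph \<times> (nat \<Rightarrow> 'v). typed_extensions (fst z) (snd z) V v"
  let ?g = "\<lambda>z a. h (fst z, (snd z)(v := a))"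
  define R where "R = {T' \<in> all_types (insert v V).
     \<forall>\<^sub>F z :: 'v ugraph \<times> (nat \<Rightarrow> 'v) in type_filter p V T. finite (?E z T') \<and> ?E z T' \<noteq> {}}"
  have fin: "finite (all_types (insert v V))" "finite R"
    using V by (auto simp: R_def finite_all_types)
  have R: "\<forall>\<^sub>F z in type_filter p V T. \<forall>T'\<in>R. finite (?E z T') \<and> ?E z T' \<noteq> {}"
    by (rule eventually_ball_finite[OF fin(2)]) (simp add: R_def)
  have "\<forall>\<^sub>F z in type_filter p V T. \<forall>T'\<in>all_types (insert v V) - R. ?E z T' = {}"
  proof (rule eventually_ball_finite, simp add: fin, rule ballI)
    fix T' assume "T' \<in> all_types (insert v V) - R"
    then have "\<forall>\<^sub>F z in type_filter p V T. finite (?E z T') \<and> ?E z T' = {}"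
      using typed_extensions_cases[of T' T] by (auto simp: R_def)
    then show "\<forall>\<^sub>F z in type_filter p V T. ?E z T' = {}" by eventually_elim simp
  qed
  then have cover: "\<forall>\<^sub>F z in type_filter p V T. fst (fst z) = (\<Union>T'\<in>R. ?E z T')"
  proof eventually_elim
    case (elim z)
    have "a \<in> (\<Union>T'\<in>R. ?E z T')" if "a \<in> fst (fst z)" for a
    proof -
      let ?T = "type_of (insert v V) (fst z) ((snd z)(v := a))"
      have "a \<in> ?E z ?T" using that by (simp add: typed_extensions_def)
      then show ?thesis using elim type_of_in_all_types[of "insert v V" "fst z" "(snd z)(v := a)"] by blast
    qed
    then show ?case by (auto simp: typed_extensions_def)
  qed
  have nonempty: "\<forall>\<^sub>F z :: 'v ugraph \<times> (nat \<Rightarrow> 'v) in type_filter p V T. fst (fst z) \<noteq> {}"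
    using eventually_N_pos[OF num_vertices_at_top] by eventually_elim auto
  have "?max \<and> ?min"
  proof (cases "R = {}")
    \<comment> \<open>Without any class the vertex set would be eventually both empty and nonempty,
      so the filter is trivial.\<close>
    case True
    have "\<forall>\<^sub>F z :: 'v ugraph \<times> (nat \<Rightarrow> 'v) in type_filter p V T. False"
      using nonempty cover by eventually_elim (use True in auto)
    then have "eventually P (type_filter p V T)" for P :: "'v ugraph \<times> (nat \<Rightarrow> 'v) \<Rightarrow> bool"
      by (rule eventually_mono) simp
    then show ?thesis by (auto intro: zero_or_power_zero)
  next
    case False
    have M: "zero_or_power (type_filter p V T) num_vertices (\<lambda>z. Max (?g z ` ?E z T'))"
      and m: "zero_or_power (type_filter p V T) num_vertices (\<lambda>z. Min (?g z ` ?E z T'))" if "T' \<in> R" for T'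
    proof -
      have in_range: "\<forall>\<^sub>F z in type_filter p V T. finite (?E z T') \<and> ?E z T' \<noteq> {}"
        using that by (simp add: R_def)
      show "zero_or_power (type_filter p V T) num_vertices (\<lambda>z. Max (?g z ` ?E z T'))"
      proof (rule zero_or_power_between[OF h[of T']])
        show "\<forall>\<^sub>F z in type_filter p V T. \<exists>a\<in>?E z T'. \<exists>b\<in>?E z T'.
            ?g z a \<le> Max (?g z ` ?E z T') \<and> Max (?g z ` ?E z T') \<le> ?g z b"
          using in_range
        proof eventually_elim
          case (elim z)
          then have "Max (?g z ` ?E z T') \<in> ?g z ` ?E z T'" by (intro Max_in) auto
          then show ?case by force
        qed
      qed
      show "zero_or_power (type_filter p V T) num_vertices (\<lambda>z. Min (?g z ` ?E z T'))"
      proof (rule zero_or_power_between[OF h[of T']])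
        show "\<forall>\<^sub>F z in type_filter p V T. \<exists>a\<in>?E z T'. \<exists>b\<in>?E z T'.
            ?g z a \<le> Min (?g z ` ?E z T') \<and> Min (?g z ` ?E z T') \<le> ?g z b"
          using in_range
        proof eventually_elim
          case (elim z)
          then have "Min (?g z ` ?E z T') \<in> ?g z ` ?E z T'" by (intro Min_in) auto
          then show ?case by force
        qed
      qed
    qed
    have Max_eq: "\<forall>\<^sub>F z in type_filter p V T.
        Max (?g z ` fst (fst z)) = Max ((\<lambda>T'. Max (?g z ` ?E z T')) ` R)"
      using cover R
    proof eventually_elim
      case (elim z)
      show ?case
        unfolding elim(1) by (rule Max_image_UN) (use elim(2) fin False in auto)
    qed
    have Min_eq: "\<forall>\<^sub>F z in type_filter p V T.
        Min (?g z ` fst (fst z)) = Min ((\<lambda>T'. Min (?g z ` ?E z T')) ` R)"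
      using cover R
    proof eventually_elim
      case (elim z)
      show ?case
        unfolding elim(1) by (rule Min_image_UN) (use elim(2) fin False in auto)
    qed
    show ?thesis
      using zero_or_power_cong[OF Max_eq zero_or_power_Max[OF num_vertices_at_top fin(2) False M]]
        zero_or_power_cong[OF Min_eq zero_or_power_Min[OF num_vertices_at_top fin(2) False m]]
      by blast
  qed
  then show ?max ?min by auto
qed

end

section \<open>Polynomial bounds from the relative Lipschitz condition\<close>

text \<open>For \<open>n \<ge> 2\<close> this says that \<open>x\<close> is 0 or lies between
  \<open>n powr (- K)\<close> and \<open>n powr K\<close>. Logarithms make quotients additive and
  suit the multiplicative steps of the Lipschitz argument.\<close>

definition pow_bounded :: "real \<Rightarrow> nat \<Rightarrow> real \<Rightarrow> bool" where
  "pow_bounded K n x \<longleftrightarrow> x = 0 \<or> x > 0 \<and> \<bar>ln x\<bar> \<le> K * ln (real n)"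

lemma pow_bounded_mono: "pow_bounded K n x \<Longrightarrow> K \<le> K' \<Longrightarrow> n \<ge> 2 \<Longrightarrow> pow_bounded K' n x"
proof -
  assume *: "pow_bounded K n x" "K \<le> K'" "n \<ge> 2"
  then have "K * ln (real n) \<le> K' * ln (real n)" by (intro mult_right_mono) auto
  with *(1) show ?thesis unfolding pow_bounded_def by linarith
qed

lemma pow_bounded_powr:
  assumes "n \<ge> 2"
  shows "pow_bounded K n x \<longleftrightarrow> x = 0 \<or> real n powr (- K) \<le> x \<and> x \<le> real n powr K"
proof (cases "x > 0")
  case True
  have "real n powr (- K) \<le> x \<longleftrightarrow> - K * ln (real n) \<le> ln x"
    using True assms by (simp add: powr_def ln_ge_iff)
  moreover have "x \<le> real n powr K \<longleftrightarrow> ln x \<le> K * ln (real n)"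
    using True assms ln_le_cancel_iff[of x "real n powr K"] by (simp add: ln_powr)
  ultimately show ?thesis using True by (auto simp: pow_bounded_def)
next
  case False
  moreover have "real n powr (- K) > 0" "real n powr K > 0" using assms by simp_all
  ultimately show ?thesis unfolding pow_bounded_def by linarith
qed

lemma pow_bounded_const:
  assumes "c \<ge> 0"
  shows "\<exists>K. \<forall>n\<ge>2. pow_bounded K n c"
proof (intro exI allI impI)
  fix n :: nat assume "n \<ge> 2"
  \<comment> \<open>Since \<open>n \<ge> 2\<close>, dividing by \<open>ln 2\<close> turns a constant
    into a multiple of \<open>ln n\<close>.\<close>
  then have "\<bar>ln c\<bar> / ln 2 * ln 2 \<le> \<bar>ln c\<bar> / ln 2 * ln (real n)"
    by (intro mult_left_mono) auto
  then show "pow_bounded (\<bar>ln c\<bar> / ln 2) n c"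
    using assms by (auto simp: pow_bounded_def)
qed

lemma pow_bounded_divide:
  assumes "pow_bounded K n x" "pow_bounded K' n y"
  shows "pow_bounded (K + K') n (x / y)"
  using assms by (auto simp: pow_bounded_def ln_div algebra_simps)

lemma pow_bounded_of_nat:
  assumes "d \<le> n"
  shows "pow_bounded 1 n (real d)"
  using assms by (cases "d = 0") (auto simp: pow_bounded_def)

text \<open>From below, one nonzero summand suffices because all are nonnegative; from above, at
  most \<open>n\<close> summands cost one more power of \<open>n\<close>.\<close>

lemma pow_bounded_sum:
  assumes "n \<ge> 2" "finite A" "card A \<le> n" "\<And>a. a \<in> A \<Longrightarrow> pow_bounded K n (f a)"
  shows "pow_bounded (K + 1) n (\<Sum>a\<in>A. f a)"
proof -
  have f: "f a = 0 \<or> real n powr (- K) \<le> f a \<and> f a \<le> real n powr K" if "a \<in> A" for a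
    using assms(4)[OF that] pow_bounded_powr[OF assms(1)] by blast
  have pos: "real n powr y > 0" for y using assms(1) by simp
  have nonneg: "f a \<ge> 0" if "a \<in> A" for a
    using f[OF that] pos[of "- K"] by linarith
  show ?thesis
  proof (cases "\<forall>a\<in>A. f a = 0")
    case True
    then show ?thesis by (simp add: pow_bounded_def)
  next
    case False
    then obtain b where b: "b \<in> A" "f b \<noteq> 0" by blast
    have "real n powr (- (K + 1)) \<le> real n powr (- K)"
      using assms(1) by (intro powr_mono) auto
    also have "\<dots> \<le> f b" using f[OF b(1)] b(2) by blast
    also have "\<dots> \<le> (\<Sum>a\<in>A. f a)"
      using b(1) assms(2) nonneg by (intro member_le_sum) auto
    finally have lower: "real n powr (- (K + 1)) \<le> (\<Sum>a\<in>A. f a)" .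
    have "(\<Sum>a\<in>A. f a) \<le> real (card A) * real n powr K"
    proof (rule sum_bounded_above)
      fix a assume "a \<in> A"
      then show "f a \<le> real n powr K" using f[of a] pos[of K] by linarith
    qed
    also have "\<dots> \<le> real n * real n powr K" using assms(3) by (intro mult_right_mono) auto
    also have "\<dots> = real n powr (K + 1)" using assms(1) by (simp add: powr_add)
    finally show ?thesis using lower pow_bounded_powr[OF assms(1)] by blast
  qed
qed

lemma uniform_constant:
  fixes P :: "'a \<Rightarrow> real \<Rightarrow> bool"
  assumes "finite A" "\<And>i. i \<in> A \<Longrightarrow> \<exists>K. P i K" "\<And>i K K'. P i K \<Longrightarrow> K \<le> K' \<Longrightarrow> P i K'"
  shows "\<exists>K. \<forall>i\<in>A. P i K"
  using assms(1,2)
proof (induction rule: finite_induct)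
  case (insert i A)
  then obtain K K' where "\<forall>j\<in>A. P j K" "P i K'" by blast
  then have "\<forall>j\<in>insert i A. P j (max K K')"
    using assms(3) by (metis insert_iff max.cobounded1 max.cobounded2)
  then show ?case by blast
qed simp

text \<open>If all coordinates of \<open>x\<close> and \<open>y\<close> agree up to a factor
  \<open>1 + c\<close>, then the quotient of norms is at most \<open>c\<close>, whatever the scale
  of the vectors; the Lipschitz condition then bounds the ratio of the values.\<close>

lemma rel_lipschitz_log_step:
  assumes "rel_lipschitz_pos m g" "\<forall>y\<in>pos_vecs m. g y > 0"
  obtains \<delta> where "\<delta> > 0"
    "\<And>x y. x \<in> pos_vecs m \<Longrightarrow> y \<in> pos_vecs m \<Longrightarrow> \<forall>i<m. \<bar>ln (x ! i) - ln (y ! i)\<bar> \<le> \<delta> \<Longrightarrow>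
       \<bar>ln (g x) - ln (g y)\<bar> \<le> ln 3"
proof -
  obtain C where C: "C > 0" and lip: "\<And>x y. x \<in> pos_vecs m \<Longrightarrow> y \<in> pos_vecs m \<Longrightarrow>
      \<bar>g x - g y\<bar> / (g x + g y)
        \<le> C * (L2_set (\<lambda>i. x ! i - y ! i) {..<m} / L2_set (\<lambda>i. x ! i + y ! i) {..<m})"
    using assms(1) unfolding rel_lipschitz_pos_def by blast
  \<comment> \<open>Chosen so that \<open>C * c\<close> is 1/2: a relative difference of at most 1/2
    between positive numbers means a ratio of at most 3.\<close>
  define c where "c = inverse (2 * C)"
  have c: "c > 0" using C by (simp add: c_def)
  define \<delta> where "\<delta> = ln (1 + c)"
  show thesis
  proof (rule that)
    show "\<delta> > 0" using c by (simp add: \<delta>_def)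
    fix x y assume xy: "x \<in> pos_vecs m" "y \<in> pos_vecs m"
      and close: "\<forall>i<m. \<bar>ln (x ! i) - ln (y ! i)\<bar> \<le> \<delta>"
    have step: "s - t \<le> c * (s + t)" if "s > 0" "t > 0" "ln s - ln t \<le> \<delta>" for s t :: real
    proof -
      have "ln s \<le> ln (t * (1 + c))" using that c by (simp add: ln_mult \<delta>_def)
      then have "s \<le> t * (1 + c)" using that c by (subst (asm) ln_le_cancel_iff) auto
      moreover have "c * s \<ge> 0" using that c by simp
      ultimately show ?thesis by (simp add: algebra_simps)
    qed
    have "L2_set (\<lambda>i. x ! i - y ! i) {..<m} = L2_set (\<lambda>i. \<bar>x ! i - y ! i\<bar>) {..<m}"
      by (simp add: L2_set_def)
    also have "\<dots> \<le> L2_set (\<lambda>i. c * (x ! i + y ! i)) {..<m}"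
    proof (rule L2_set_mono)
      fix i assume "i \<in> {..<m}"
      then have "x ! i > 0" "y ! i > 0" "\<bar>ln (x ! i) - ln (y ! i)\<bar> \<le> \<delta>"
        using xy close by (auto simp: pos_vecs_def)
      then show "\<bar>x ! i - y ! i\<bar> \<le> c * (x ! i + y ! i)"
        using step[of "x ! i" "y ! i"] step[of "y ! i" "x ! i"] by (simp add: add.commute abs_le_iff)
    qed simp
    also have "\<dots> = c * L2_set (\<lambda>i. x ! i + y ! i) {..<m}"
      using c by (simp add: L2_set_right_distrib)
    finally have "L2_set (\<lambda>i. x ! i - y ! i) {..<m} / L2_set (\<lambda>i. x ! i + y ! i) {..<m} \<le> c"
      using c by (cases "L2_set (\<lambda>i. x ! i + y ! i) {..<m} = 0")
        (auto simp: pos_divide_le_eq less_le)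
    then have "\<bar>g x - g y\<bar> / (g x + g y) \<le> C * c"
      using lip[OF xy] C by (meson mult_left_mono less_imp_le order_trans)
    then have "\<bar>g x - g y\<bar> / (g x + g y) \<le> 1 / 2" using C by (simp add: c_def)
    moreover have g: "g x > 0" "g y > 0" using xy assms(2) by auto
    ultimately have "\<bar>g x - g y\<bar> \<le> (g x + g y) / 2" by (simp add: pos_divide_le_eq)
    from this[unfolded abs_le_iff] have "g x \<le> 3 * g y" "g y \<le> 3 * g x"
      by (simp_all add: field_simps)
    then have "ln (g x) \<le> ln (3 * g y)" "ln (g y) \<le> ln (3 * g x)" using g by simp_all
    then show "\<bar>ln (g x) - ln (g y)\<bar> \<le> ln 3" using g by (simp add: ln_mult)
  qed
qed

text \<open>Interpolate geometrically between the all-ones vector and \<open>x\<close>; each of the \<open>O(log n)\<close> steps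
  changes \<open>g\<close> by at most a factor 3.\<close>

lemma rel_lipschitz_pow_bounded:
  assumes "rel_lipschitz_pos m g" "\<forall>y\<in>pos_vecs m. g y > 0" "k \<ge> 0"
  shows "\<exists>K. \<forall>n\<ge>2. \<forall>x\<in>pos_vecs m. (\<forall>i<m. pow_bounded k n (x ! i)) \<longrightarrow> pow_bounded K n (g x)"
proof -
  obtain \<delta> where \<delta>: "\<delta> > 0" and step:
    "\<And>x y. x \<in> pos_vecs m \<Longrightarrow> y \<in> pos_vecs m \<Longrightarrow> \<forall>i<m. \<bar>ln (x ! i) - ln (y ! i)\<bar> \<le> \<delta> \<Longrightarrow>
       \<bar>ln (g x) - ln (g y)\<bar> \<le> ln 3"
    using rel_lipschitz_log_step[OF assms(1,2)] by blast
  \<comment> \<open>The term \<open>2 * ln 3\<close> pays for rounding the number of steps up, by at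
    most 2.\<close>
  define D where "D = \<bar>ln (g (replicate m 1))\<bar> + 2 * ln 3"
  define K where "K = D / ln 2 + k * ln 3 / \<delta>"
  have "pow_bounded K n (g x)"
    if n: "n \<ge> 2" and x: "x \<in> pos_vecs m" and bound: "\<forall>i<m. pow_bounded k n (x ! i)" for n x
  proof -
    define L where "L = k * ln (real n)"
    have ln_n: "ln (real n) \<ge> ln 2" using n by simp
    then have L: "L \<ge> 0" using assms(3) n by (simp add: L_def)
    have x_pos: "x ! i > 0" if "i < m" for i using x that by (auto simp: pos_vecs_def)
    have x_ln: "\<bar>ln (x ! i)\<bar> \<le> L" if "i < m" for i
      using bound that x_pos[OF that] by (auto simp: pow_bounded_def L_def)
    \<comment> \<open>With \<open>r\<close> equal steps on the logarithmic scale each coordinate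
      moves by at most \<open>\<delta>\<close> per step; adding 1 keeps \<open>r\<close> positive
      when \<open>L = 0\<close>.\<close>
    define r where "r = nat \<lceil>L / \<delta>\<rceil> + 1"
    have r: "L / \<delta> \<le> real r" "real r \<le> L / \<delta> + 2" "r > 0"
      using L \<delta> by (auto simp: r_def) linarith+
    define y where "y j = map (\<lambda>i. exp (real j / real r * ln (x ! i))) [0..<m]" for j
    have y_pos: "y j \<in> pos_vecs m" for j by (auto simp: y_def pos_vecs_def)
    have "\<bar>ln (g (y j)) - ln (g (y 0))\<bar> \<le> real j * ln 3" for j
    proof (induction j)
      case (Suc j)
      have "\<bar>ln (y (Suc j) ! i) - ln (y j ! i)\<bar> \<le> \<delta>" if "i < m" for i
      proof -
        have "ln (y (Suc j) ! i) - ln (y j ! i) = ln (x ! i) / real r"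
          using that by (simp add: y_def ring_distribs add_divide_distrib)
        moreover have "\<bar>ln (x ! i)\<bar> / real r \<le> \<delta>"
          using x_ln[OF that] r(1,3) \<delta> by (simp add: field_simps)
        ultimately show ?thesis by simp
      qed
      then have "\<bar>ln (g (y (Suc j))) - ln (g (y j))\<bar> \<le> ln 3"
        by (intro step y_pos) auto
      then show ?case using Suc by (simp add: algebra_simps)
    qed simp
    note this[of r]
    moreover have "y r = x"
      using x x_pos r(3) by (intro nth_equalityI) (auto simp: y_def pos_vecs_def)
    moreover have "y 0 = replicate m 1" by (intro nth_equalityI) (auto simp: y_def)
    ultimately have "\<bar>ln (g x) - ln (g (replicate m 1))\<bar> \<le> real r * ln 3" by simp
    also have "\<dots> \<le> (L / \<delta> + 2) * ln 3" using r(2) by (intro mult_right_mono) auto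
    finally have "\<bar>ln (g x)\<bar> \<le> D + k * ln 3 / \<delta> * ln (real n)"
      by (simp add: D_def L_def algebra_simps)
    also have "D \<le> D / ln 2 * ln (real n)"
    proof -
      have "D \<ge> 0" by (simp add: D_def)
      then have "D / ln 2 * ln 2 \<le> D / ln 2 * ln (real n)" using ln_n by (intro mult_left_mono) auto
      then show ?thesis by simp
    qed
    finally show ?thesis using assms(2) x by (simp add: pow_bounded_def K_def algebra_simps)
  qed
  then show ?thesis by blast
qed

text \<open>A bound is found for each possible support of the argument, from the corresponding
  specialisation or, for the zero vector, from a constant. There are finitely many supports, so one
  exponent serves all.\<close>

lemma rel_lipschitz_fun_pow_bounded:
  assumes f: "rel_lipschitz m f" "\<forall>x\<in>nonneg_vecs m. f x \<ge> 0" and k: "k \<ge> 0"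
  shows "\<exists>K. \<forall>n\<ge>2. \<forall>x. length x = m \<longrightarrow> (\<forall>i<m. pow_bounded k n (x ! i)) \<longrightarrow> pow_bounded K n (f x)"
proof -
  define P where "P I K \<longleftrightarrow> (\<forall>n\<ge>2. \<forall>x. length x = m \<longrightarrow> {i. i < m \<and> x ! i \<noteq> 0} = I \<longrightarrow>
      (\<forall>i<m. pow_bounded k n (x ! i)) \<longrightarrow> pow_bounded K n (f x))" for I K
  have "\<exists>K. \<forall>I\<in>Pow {..<m}. P I K"
  proof (rule uniform_constant)
    fix I assume I: "I \<in> Pow {..<m}"
    show "\<exists>K. P I K"
    proof (cases "I = {}")
      case True
      have "f (replicate m 0) \<ge> 0" using f(2) by (auto simp: nonneg_vecs_def)
      then obtain K where K: "\<forall>n\<ge>2. pow_bounded K n (f (replicate m 0))"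
        using pow_bounded_const by blast
      have zero: "x = replicate m 0" if "length x = m" "{i. i < m \<and> x ! i \<noteq> 0} = I" for x :: "real list"
        using that True by (intro nth_equalityI) auto
      have "pow_bounded K n (f x)" if "n \<ge> 2" "length x = m" "{i. i < m \<and> x ! i \<noteq> 0} = I" for n x
        unfolding zero[OF that(2,3)] using K that(1) by blast
      then have "P I K" by (simp add: P_def)
      then show ?thesis ..
    next
      case False
      have fin: "finite I" using I finite_subset by auto
      have *: "compress I x \<in> pos_vecs (card I)"
        "specialisation m I f (compress I x) = f x"
        "\<forall>i<card I. pow_bounded k n (compress I x ! i)"
        if "length x = m" "{i. i < m \<and> x ! i \<noteq> 0} = I" "\<forall>i<m. pow_bounded k n (x ! i)"
        for x :: "real list" and n
      proof -
        have i: "i < m \<and> x ! i > 0" if "i \<in> I" for i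
          using that \<open>{i. i < m \<and> x ! i \<noteq> 0} = I\<close> \<open>\<forall>i<m. pow_bounded k n (x ! i)\<close>
          by (auto simp: pow_bounded_def)
        show "compress I x \<in> pos_vecs (card I)" using compress_in_pos_vecs fin i by blast
        show "specialisation m I f (compress I x) = f x"
          using specialisation_compress[of I x f] that I by auto
        show "\<forall>i<card I. pow_bounded k n (compress I x ! i)"
          using that i inv_into_index_in[OF fin] by (simp add: nth_compress)
      qed
      consider "\<forall>y\<in>pos_vecs (card I). specialisation m I f y > 0"
          "rel_lipschitz_pos (card I) (specialisation m I f)"
        | "\<forall>y\<in>pos_vecs (card I). specialisation m I f y = 0"
        using f(1) I False unfolding rel_lipschitz_def by blast
      then show ?thesis
      proof cases
        case 1
        then obtain K where K: "\<forall>n\<ge>2. \<forall>x\<in>pos_vecs (card I). (\<forall>i<card I. pow_bounded k n (x ! i)) \<longrightarrow>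
            pow_bounded K n (specialisation m I f x)"
          using rel_lipschitz_pow_bounded[OF 1(2,1) k] by blast
        have "pow_bounded K n (f x)"
          if "n \<ge> 2" "length x = m" "{i. i < m \<and> x ! i \<noteq> 0} = I" "\<forall>i<m. pow_bounded k n (x ! i)" for n x
          using K[rule_format, OF that(1) *(1)[OF that(2-4)]] *(2,3)[OF that(2-4)] by simp
        then have "P I K" unfolding P_def by blast
        then show ?thesis ..
      next
        case 2
        then have "f x = 0"
          if "length x = m" "{i. i < m \<and> x ! i \<noteq> 0} = I" "\<forall>i<m. pow_bounded k n (x ! i)" for n x
          using *(1,2)[OF that] by simp
        then have "P I 0" unfolding P_def pow_bounded_def by blast
        then show ?thesis ..
      qed
    qed
  next
    show "P I K'" if P: "P I K" "K \<le> K'" for I K K'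
      unfolding P_def
    proof (intro allI impI)
      fix n :: nat and x
      assume *: "n \<ge> 2" "length x = m" "{i. i < m \<and> x ! i \<noteq> 0} = I" "\<forall>i<m. pow_bounded k n (x ! i)"
      have "pow_bounded K n (f x)" using P(1) * unfolding P_def by blast
      then show "pow_bounded K' n (f x)" using P(2) *(1) by (rule pow_bounded_mono)
    qed
  qed simp
  then obtain K where K: "\<forall>I\<in>Pow {..<m}. P I K" by blast
  have "pow_bounded K n (f x)"
    if "n \<ge> 2" "length x = m" "\<forall>i<m. pow_bounded k n (x ! i)" for n x
    using K[rule_format, of "{i. i < m \<and> x ! i \<noteq> 0}"] that unfolding P_def by auto
  then show ?thesis by blast
qed

text \<open>This holds on every finite graph with at least two vertices, quasirandom or not, and so
  covers the exceptional graphs.\<close>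

lemma eval_term_pow_bounded:
  assumes "t \<in> Agg F_rlpoly"
  shows "\<exists>K. \<forall>(G :: 'v ugraph) \<sigma>. finite (fst G) \<longrightarrow> card (fst G) \<ge> 2 \<longrightarrow>
           pow_bounded K (card (fst G)) (eval_term G \<sigma> t)"
  using assms
proof (induction rule: Agg.induct)
  case (1 c)
  then show ?case using pow_bounded_const[of c] by auto
next
  case (2 u v)
  show ?case by (intro exI[of _ 0]) (auto simp: pow_bounded_def)
next
  case (3 u v)
  show ?case by (intro exI[of _ 0]) (auto simp: pow_bounded_def)
next
  case (4 f ts)
  have "\<exists>k. \<forall>t\<in>set ts. \<forall>(G :: 'v ugraph) \<sigma>. finite (fst G) \<longrightarrow> card (fst G) \<ge> 2 \<longrightarrow>
           pow_bounded k (card (fst G)) (eval_term G \<sigma> t)"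
  proof (rule uniform_constant)
    show "\<exists>k. \<forall>(G :: 'v ugraph) \<sigma>. finite (fst G) \<longrightarrow> card (fst G) \<ge> 2 \<longrightarrow>
           pow_bounded k (card (fst G)) (eval_term G \<sigma> t)" if "t \<in> set ts" for t
      using 4(2) that by blast
    show "\<forall>(G :: 'v ugraph) \<sigma>. finite (fst G) \<longrightarrow> card (fst G) \<ge> 2 \<longrightarrow>
        pow_bounded K' (card (fst G)) (eval_term G \<sigma> t)"
      if "\<forall>(G :: 'v ugraph) \<sigma>. finite (fst G) \<longrightarrow> card (fst G) \<ge> 2 \<longrightarrow>
        pow_bounded K (card (fst G)) (eval_term G \<sigma> t)" "K \<le> K'" for t K K'
      by (intro allI impI pow_bounded_mono[OF that(1)[rule_format] that(2)])
  qed simp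
  then obtain k where k: "\<forall>t\<in>set ts. \<forall>(G :: 'v ugraph) \<sigma>. finite (fst G) \<longrightarrow> card (fst G) \<ge> 2 \<longrightarrow>
           pow_bounded k (card (fst G)) (eval_term G \<sigma> t)" by blast
  have "rel_lipschitz (length ts) f" "\<forall>x\<in>nonneg_vecs (length ts). f x \<ge> 0"
    using 4(1) by (auto simp: F_rlpoly_def)
  \<comment> \<open>The Lipschitz bound is stated for nonnegative exponents, hence
    \<open>max k 0\<close>.\<close>
  then obtain K where K: "\<forall>n\<ge>2. \<forall>x. length x = length ts \<longrightarrow>
      (\<forall>i<length ts. pow_bounded (max k 0) n (x ! i)) \<longrightarrow> pow_bounded K n (f x)"
    using rel_lipschitz_fun_pow_bounded[of "length ts" f "max k 0"] by auto
  show ?case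
  proof (intro exI allI impI)
    fix G :: "'v ugraph" and \<sigma>
    assume G: "finite (fst G)" "2 \<le> card (fst G)"
    have "pow_bounded (max k 0) (card (fst G)) (eval_term G \<sigma> (ts ! i))" if "i < length ts" for i
      using k[rule_format, OF nth_mem[OF that] G] pow_bounded_mono[OF _ max.cobounded1 G(2)] by blast
    then show "pow_bounded K (card (fst G)) (eval_term G \<sigma> (Fn f ts))"
      using K G by simp
  qed
next
  case (5 t v)
  then obtain K where K: "\<forall>(G :: 'v ugraph) \<sigma>. finite (fst G) \<longrightarrow> card (fst G) \<ge> 2 \<longrightarrow>
      pow_bounded K (card (fst G)) (eval_term G \<sigma> t)" by blast
  show ?case
  proof (intro exI allI impI)
    fix G :: "'v ugraph" and \<sigma>
    assume G: "finite (fst G)" "2 \<le> card (fst G)"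
    \<comment> \<open>One unit is spent on the sum, the other on dividing by the number of
      summands.\<close>
    show "pow_bounded (K + 1 + 1) (card (fst G)) (eval_term G \<sigma> (Avg v t))"
      unfolding eval_term.simps
      by (intro pow_bounded_divide pow_bounded_sum pow_bounded_of_nat order_refl G K[rule_format])
  qed
next
  case (6 t w v)
  then obtain K where K: "\<forall>(G :: 'v ugraph) \<sigma>. finite (fst G) \<longrightarrow> card (fst G) \<ge> 2 \<longrightarrow>
      pow_bounded K (card (fst G)) (eval_term G \<sigma> t)" by blast
  show ?case
  proof (intro exI allI impI)
    fix G :: "'v ugraph" and \<sigma>
    assume G: "finite (fst G)" "2 \<le> card (fst G)"
    have nb: "neighbours G a \<subseteq> fst G" for a by (auto simp: neighbours_def)
    have fin: "finite (neighbours G a)" "card (neighbours G a) \<le> card (fst G)" for a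
      using G nb by (auto intro: finite_subset card_mono)
    have "pow_bounded (K + 1 + 1) (card (fst G))
        ((\<Sum>a\<in>neighbours G (\<sigma> w). eval_term G (\<sigma>(v := a)) t) / real (card (neighbours G (\<sigma> w))))"
      by (intro pow_bounded_divide pow_bounded_sum pow_bounded_of_nat fin G K[rule_format])
    then show "pow_bounded (K + 1 + 1) (card (fst G)) (eval_term G \<sigma> (LAvg w v t))"
      by (cases "neighbours G (\<sigma> w) = {}") (simp_all add: pow_bounded_def)
  qed
next
  case (7 t v)
  then obtain K where K: "\<forall>(G :: 'v ugraph) \<sigma>. finite (fst G) \<longrightarrow> card (fst G) \<ge> 2 \<longrightarrow>
      pow_bounded K (card (fst G)) (eval_term G \<sigma> t)" by blast
  show ?case
  proof (intro exI allI impI)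
    fix G :: "'v ugraph" and \<sigma>
    assume G: "finite (fst G)" "2 \<le> card (fst G)"
    then have "eval_term G \<sigma> (MaxT v t) \<in> (\<lambda>a. eval_term G (\<sigma>(v := a)) t) ` fst G"
      unfolding eval_term.simps by (intro Max_in) auto
    then obtain a where a: "eval_term G \<sigma> (MaxT v t) = eval_term G (\<sigma>(v := a)) t" by blast
    show "pow_bounded K (card (fst G)) (eval_term G \<sigma> (MaxT v t))"
      unfolding a by (rule K[rule_format, OF G])
  qed
next
  case (8 t v)
  then obtain K where K: "\<forall>(G :: 'v ugraph) \<sigma>. finite (fst G) \<longrightarrow> card (fst G) \<ge> 2 \<longrightarrow>
      pow_bounded K (card (fst G)) (eval_term G \<sigma> t)" by blast
  show ?case
  proof (intro exI allI impI)
    fix G :: "'v ugraph" and \<sigma>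
    assume G: "finite (fst G)" "2 \<le> card (fst G)"
    then have "eval_term G \<sigma> (MinT v t) \<in> (\<lambda>a. eval_term G (\<sigma>(v := a)) t) ` fst G"
      unfolding eval_term.simps by (intro Min_in) auto
    then obtain a where a: "eval_term G \<sigma> (MinT v t) = eval_term G (\<sigma>(v := a)) t" by blast
    show "pow_bounded K (card (fst G)) (eval_term G \<sigma> (MinT v t))"
      unfolding a by (rule K[rule_format, OF G])
  qed
next
  case (9 t v)
  then obtain K where K: "\<forall>(G :: 'v ugraph) \<sigma>. finite (fst G) \<longrightarrow> card (fst G) \<ge> 2 \<longrightarrow>
      pow_bounded K (card (fst G)) (eval_term G \<sigma> t)" by blast
  show ?case
  proof (intro exI allI impI)
    fix G :: "'v ugraph" and \<sigma>
    assume G: "finite (fst G)" "2 \<le> card (fst G)"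
    show "pow_bounded (K + 1) (card (fst G)) (eval_term G \<sigma> (SumT v t))"
      unfolding eval_term.simps by (intro pow_bounded_sum order_refl G K[rule_format])
  qed
qed

section \<open>The zero-or-power dichotomy for terms\<close>

text \<open>Any finite \<open>V\<close> containing the free variables is allowed, so that all
  arguments of a function symbol are compared along the same filter.\<close>

lemma eval_zero_or_power:
  assumes p: "0 < p" "p < 1" and t: "t \<in> Agg F_rlpoly"
  shows "finite V \<Longrightarrow> free_vars t \<subseteq> V \<Longrightarrow>
    zero_or_power (type_filter p V T) num_vertices (\<lambda>z :: 'v ugraph \<times> (nat \<Rightarrow> 'v). eval_term (fst z) (snd z) t)"
  using t
proof (induction arbitrary: V T rule: Agg.induct)
  case (1 c)
  then show ?case by (simp add: zero_or_power_const[OF num_vertices_at_top])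
next
  case (2 u v)
  have "\<forall>\<^sub>F z :: 'v ugraph \<times> (nat \<Rightarrow> 'v) in type_filter p V T.
      eval_term (fst z) (snd z) (Edge u v) = (if (u, v) \<in> snd T then 1 else 0)"
    by (rule eventually_type_filterI[of _ 0]) (use 2 in \<open>auto simp: type_of_def\<close>)
  then show ?case by (rule zero_or_power_cong) (simp add: zero_or_power_const[OF num_vertices_at_top])
next
  case (3 u v)
  have "\<forall>\<^sub>F z :: 'v ugraph \<times> (nat \<Rightarrow> 'v) in type_filter p V T.
      eval_term (fst z) (snd z) (Equal u v) = (if (u, v) \<in> fst T then 1 else 0)"
    by (rule eventually_type_filterI[of _ 0]) (use 3 in \<open>auto simp: type_of_def\<close>)
  then show ?case by (rule zero_or_power_cong) (simp add: zero_or_power_const[OF num_vertices_at_top])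
next
  case (4 f ts)
  let ?hs = "map (\<lambda>t (z :: 'v ugraph \<times> (nat \<Rightarrow> 'v)). eval_term (fst z) (snd z) t) ts"
  have f: "asymp_poly (length ?hs) f" "\<forall>x\<in>nonneg_vecs (length ?hs). f x \<ge> 0"
    using 4(1) by (auto simp: F_rlpoly_def)
  have "zero_or_power (type_filter p V T) num_vertices h" if "h \<in> set ?hs" for h
    using that 4 by (cases T) auto
  from zero_or_power_fun[OF num_vertices_at_top f this] show ?case by (simp add: o_def)
next
  case (5 t v)
  have h: "zero_or_power (type_filter p (insert v (V - {v})) T') num_vertices
      (\<lambda>z :: 'v ugraph \<times> (nat \<Rightarrow> 'v). eval_term (fst z) (snd z) t)" for T'
    using 5 by (intro 5(2)) auto
  have "zero_or_power (type_filter p V T) num_vertices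
      (\<lambda>z :: 'v ugraph \<times> (nat \<Rightarrow> 'v). \<Sum>a\<in>fst (fst z). eval_term (fst z) ((snd z)(v := a)) t)"
    by (rule zero_or_power_mono[OF type_filter_mono[of "V - {v}"]])
       (use zero_or_power_sum_vertices[OF p _ _ h] 5(3) in auto)
  from zero_or_power_divide[OF num_vertices_at_top this zero_or_power_N[OF num_vertices_at_top]]
  show ?case by simp
next
  case (6 t w v)
  define V\<^sub>0 where "V\<^sub>0 = V - {v}"
  have V0: "finite V\<^sub>0" "v \<notin> V\<^sub>0" "w \<in> V\<^sub>0" "V\<^sub>0 \<subseteq> V"
    using 6 by (auto simp: V\<^sub>0_def)
  have sum: "zero_or_power (type_filter p V T) num_vertices
      (\<lambda>z :: 'v ugraph \<times> (nat \<Rightarrow> 'v). \<Sum>a\<in>neighbours (fst z) (snd z w). g (fst z, (snd z)(v := a)))"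
    if g: "\<And>T'. zero_or_power (type_filter p (insert v V\<^sub>0) T') num_vertices g"
    for g :: "'v ugraph \<times> (nat \<Rightarrow> 'v) \<Rightarrow> real"
  proof -
    \<comment> \<open>A sum over neighbours becomes a sum over all vertices with the non-neighbours
      set to 0. Adjacency to \<open>w\<close> is part of the extended type, so \<open>h\<close>
      eventually equals \<open>g\<close> or 0 on each type.\<close>
    define h where "h z = (if {snd z w, snd z v} \<in> snd (fst z) then g z else 0)"
      for z :: "'v ugraph \<times> (nat \<Rightarrow> 'v)"
    have h: "zero_or_power (type_filter p (insert v V\<^sub>0) T') num_vertices h" for T'
    proof (cases "(w, v) \<in> snd T'")
      case True
      have "\<forall>\<^sub>F z in type_filter p (insert v V\<^sub>0) T'. h z = g z"
        by (rule eventually_type_filterI[of _ 0]) (use True in \<open>auto simp: type_of_def h_def\<close>)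
      then show ?thesis using g by (rule zero_or_power_cong)
    next
      case False
      have "\<forall>\<^sub>F z in type_filter p (insert v V\<^sub>0) T'. h z = 0"
        by (rule eventually_type_filterI[of _ 0]) (use False V0 in \<open>auto simp: type_of_def h_def\<close>)
      then show ?thesis by (rule zero_or_power_zero)
    qed
    have "\<forall>\<^sub>F z in type_filter p V T.
        (\<Sum>a\<in>neighbours (fst z) (snd z w). g (fst z, (snd z)(v := a))) = (\<Sum>a\<in>fst (fst z). h (fst z, (snd z)(v := a)))"
      using eventually_finite
    proof eventually_elim
      case (elim z)
      have "v \<noteq> w" using V0 by auto
      then show ?case
        unfolding neighbours_def h_def using elim by (simp add: sum.inter_filter)
    qed
    moreover have "zero_or_power (type_filter p V T) num_vertices (\<lambda>z. \<Sum>a\<in>fst (fst z). h (fst z, (snd z)(v := a)))"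
      by (rule zero_or_power_mono[OF type_filter_mono[OF V0(4)] zero_or_power_sum_vertices[OF p V0(1,2) h]])
    ultimately show ?thesis by (rule zero_or_power_cong)
  qed
  have "zero_or_power (type_filter p (insert v V\<^sub>0) T') num_vertices
      (\<lambda>z :: 'v ugraph \<times> (nat \<Rightarrow> 'v). eval_term (fst z) (snd z) t)" for T'
    using 6 by (intro 6(3)) (auto simp: V\<^sub>0_def)
  \<comment> \<open>The degree is the same sum with \<open>g\<close> constantly 1. For an isolated
    vertex the quotient is 0 / 0 = 0, as \<open>LAvg\<close> prescribes.\<close>
  from zero_or_power_divide[OF num_vertices_at_top sum[OF this] sum[of "\<lambda>_. 1"]]
  have "zero_or_power (type_filter p V T) num_vertices
      (\<lambda>z :: 'v ugraph \<times> (nat \<Rightarrow> 'v). (\<Sum>a\<in>neighbours (fst z) (snd z w). eval_term (fst z) ((snd z)(v := a)) t)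
         / real (card (neighbours (fst z) (snd z w))))"
    by (simp add: zero_or_power_const[OF num_vertices_at_top])
  then show ?case
    by (rule zero_or_power_cong[rotated]) simp
next
  case (7 t v)
  have h: "zero_or_power (type_filter p (insert v (V - {v})) T') num_vertices
      (\<lambda>z :: 'v ugraph \<times> (nat \<Rightarrow> 'v). eval_term (fst z) (snd z) t)" for T'
    using 7 by (intro 7(2)) auto
  show ?case
    by (rule zero_or_power_mono[OF type_filter_mono[of "V - {v}"]])
       (use zero_or_power_Max_Min_vertices(1)[OF p _ _ h] 7(3) in auto)
next
  case (8 t v)
  have h: "zero_or_power (type_filter p (insert v (V - {v})) T') num_vertices
      (\<lambda>z :: 'v ugraph \<times> (nat \<Rightarrow> 'v). eval_term (fst z) (snd z) t)" for T'
    using 8 by (intro 8(2)) auto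
  show ?case
    by (rule zero_or_power_mono[OF type_filter_mono[of "V - {v}"]])
       (use zero_or_power_Max_Min_vertices(2)[OF p _ _ h] 8(3) in auto)
next
  case (9 t v)
  have h: "zero_or_power (type_filter p (insert v (V - {v})) T') num_vertices
      (\<lambda>z :: 'v ugraph \<times> (nat \<Rightarrow> 'v). eval_term (fst z) (snd z) t)" for T'
    using 9 by (intro 9(2)) auto
  show ?case
    by (rule zero_or_power_mono[OF type_filter_mono[of "V - {v}"]])
       (use zero_or_power_sum_vertices[OF p _ _ h] 9(3) in auto)
qed

section \<open>Quasirandomness of the random graph\<close>

lemma finite_vertex_pairs: "finite (vertex_pairs n)"
  by (rule finite_subset[of _ "Pow {1..n}"]) (auto simp: vertex_pairs_def)

lemma set_pmf_gnp:
  assumes "G \<in> set_pmf (gnp n p)"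
  shows "fst G = {1..n}" "snd G \<subseteq> vertex_pairs n"
  using assms by (auto simp: gnp_def)

lemma finite_set_pmf_gnp: "finite (set_pmf (gnp n p))"
proof (rule finite_subset)
  show "set_pmf (gnp n p) \<subseteq> {{1..n}} \<times> Pow (vertex_pairs n)" using set_pmf_gnp by fastforce
qed (simp add: finite_vertex_pairs)

text \<open>For distinct \<open>a\<close> outside \<open>A \<union> B\<close>, the events that \<open>a\<close> is an extension depend on disjoint sets
  of edges, so Hoeffding's inequality applies.\<close>

lemma prob_extension_deviation:
  assumes p: "0 < p" "p < 1" and AB: "A \<subseteq> {1..n}" "B \<subseteq> {1..n}" "A \<inter> B = {}" "card (A \<union> B) < n" and "\<epsilon> \<ge> 0"
  defines "s \<equiv> real (card ({1..n} - (A \<union> B)))"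
  shows "measure_pmf.prob (gnp n p)
     {G. \<bar>real (card (extensions G A B)) - s * (p ^ card A * (1 - p) ^ card B)\<bar> \<ge> \<epsilon>}
     \<le> 2 * exp (- 2 * \<epsilon>\<^sup>2 / s)"
proof -
  define S where "S = {1..n} - (A \<union> B)"
  define M where "M = Pi_pmf (vertex_pairs n) False (\<lambda>_. bernoulli_pmf p)"
  \<comment> \<open>The edges inspected when deciding whether \<open>a\<close> is an extension. For
    distinct \<open>a\<close> outside \<open>A \<union> B\<close> these sets are disjoint, which
    gives independence.\<close>
  define K where "K a = (\<lambda>x. {x, a}) ` (A \<union> B)" for a :: nat
  define ok where "ok a \<omega> \<longleftrightarrow> (\<forall>x\<in>A. \<omega> {x, a}) \<and> (\<forall>x\<in>B. \<not> \<omega> {x, a})" for a and \<omega> :: "nat set \<Rightarrow> bool"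
  define X where "X a \<omega> = (if ok a \<omega> then 1 else 0 :: real)" for a \<omega>
  have fin: "finite A" "finite B" "finite S" using AB by (auto simp: S_def intro: finite_subset)
  have pair: "{x, a} \<in> vertex_pairs n" if "a \<in> S" "x \<in> A \<union> B" for x a
    using that AB by (auto simp: S_def vertex_pairs_def card_2_iff)
  have K: "K a \<subseteq> vertex_pairs n" if "a \<in> S" for a using pair[OF that] by (auto simp: K_def)
  have disj: "disjoint_family_on K S"
    by (auto simp: disjoint_family_on_def K_def S_def doubleton_eq_iff)
  have ind: "prob_space.indep_vars (measure_pmf M) (\<lambda>j. PiM (K j) (\<lambda>_. count_space UNIV)) (\<lambda>j \<omega>. restrict (\<lambda>i. \<omega> i) (K j)) S"
    by (rule prob_space.indep_vars_restrict[OF measure_pmf.prob_space_axioms indep_vars_Pi_pmf[OF finite_vertex_pairs, of n False "\<lambda>_. bernoulli_pmf p", folded M_def] K disj])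
  have "prob_space.indep_vars (measure_pmf M) (\<lambda>_. borel) (\<lambda>j \<omega>. X j (restrict (\<lambda>i. \<omega> i) (K j))) S"
  proof (rule prob_space.indep_vars_compose2[OF measure_pmf.prob_space_axioms ind])
    fix a assume "a \<in> S"
    have [measurable]: "(\<lambda>\<omega>. \<omega> {x, a}) \<in> measurable (PiM (K a) (\<lambda>_. count_space UNIV)) (count_space (UNIV :: bool set))"
      if "x \<in> A \<union> B" for x
      by (rule measurable_component_singleton) (use that in \<open>auto simp: K_def\<close>)
    have [measurable]: "Measurable.pred (PiM (K a) (\<lambda>_. count_space UNIV)) (ok a)"
      unfolding ok_def using fin by (intro pred_intros_logic pred_intros_finite) auto
    show "X a \<in> borel_measurable (PiM (K a) (\<lambda>_. count_space UNIV))"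
      unfolding X_def by measurable
  qed
  moreover have "X a (restrict \<omega> (K a)) = X a \<omega>" for a \<omega>
    by (auto simp: X_def ok_def K_def)
  ultimately have indep: "prob_space.indep_vars (measure_pmf M) (\<lambda>_. borel) X S" by simp
  interpret H: Hoeffding_ineq "measure_pmf M" S X "\<lambda>_. 0" "\<lambda>_. 1" "\<Sum>a\<in>S. measure_pmf.expectation M (X a)"
    by unfold_locales (use indep fin in \<open>auto simp: X_def\<close>)
  have EX: "measure_pmf.expectation M (X a) = p ^ card A * (1 - p) ^ card B" if a: "a \<in> S" for a
  proof -
    define EA where "EA = (\<lambda>x. {x, a}) ` A"
    define EB where "EB = (\<lambda>x. {x, a}) ` B"
    have sub: "EA \<subseteq> vertex_pairs n" "EB \<subseteq> vertex_pairs n"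
      using pair[OF a] by (auto simp: EA_def EB_def)
    have disjE: "EA \<inter> EB = {}" using AB(3) by (auto simp: EA_def EB_def doubleton_eq_iff)
    have inj: "inj_on (\<lambda>x. {x, a}) Y" for Y by (auto simp: inj_on_def doubleton_eq_iff)
    have cards: "card EA = card A" "card EB = card B"
      unfolding EA_def EB_def by (intro card_image inj)+
    \<comment> \<open>The admissible states of each edge, so that the event becomes a product set
      and its probability a product over edges.\<close>
    define R where "R e = (if e \<in> EA then {True} else if e \<in> EB then {False} else UNIV)" for e
    have ok: "ok a \<omega> \<longleftrightarrow> (\<forall>e\<in>EA. \<omega> e) \<and> (\<forall>e\<in>EB. \<not> \<omega> e)" for \<omega>
      by (simp add: ok_def EA_def EB_def)
    have R: "\<omega> e \<in> R e \<longleftrightarrow> (e \<in> EA \<longrightarrow> \<omega> e) \<and> (e \<in> EB \<longrightarrow> \<not> \<omega> e)" for \<omega> e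
      using disjE by (auto simp: R_def)
    have "{\<omega>. ok a \<omega>} = Pi (vertex_pairs n) R"
      unfolding Pi_def R ok using sub by blast
    moreover have "X a = indicator {\<omega>. ok a \<omega>}" by (auto simp: X_def fun_eq_iff)
    ultimately have "measure_pmf.expectation M (X a) = measure_pmf.prob M (Pi (vertex_pairs n) R)"
      by simp
    also have "\<dots> = (\<Prod>e\<in>vertex_pairs n. measure_pmf.prob (bernoulli_pmf p) (R e))"
      unfolding M_def by (rule measure_Pi_pmf_Pi[OF finite_vertex_pairs])
    also have "\<dots> = (\<Prod>e\<in>vertex_pairs n. (if e \<in> EA then p else 1) * (if e \<in> EB then 1 - p else 1))"
      using p disjE by (intro prod.cong refl) (auto simp: R_def measure_pmf_single)
    also have "\<dots> = p ^ card EA * (1 - p) ^ card EB"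
      using sub finite_vertex_pairs[of n]
      by (simp add: prod.distrib prod.If_cases Int_absorb1 Int_absorb2)
    finally show ?thesis by (simp add: cards)
  qed
  have s: "s = real (card S)" by (simp add: s_def S_def)
  have "card S > 0"
  proof -
    have "card S = n - card (A \<union> B)" unfolding S_def using AB fin by (subst card_Diff_subset) auto
    then show ?thesis using AB(4) by simp
  qed
  then have *: "measure_pmf.prob M {\<omega>\<in>space (measure_pmf M). \<bar>(\<Sum>a\<in>S. X a \<omega>) - (\<Sum>a\<in>S. measure_pmf.expectation M (X a))\<bar> \<ge> \<epsilon>}
      \<le> 2 * exp (- 2 * \<epsilon>\<^sup>2 / (\<Sum>a\<in>S. (1 - 0)\<^sup>2))"
    by (intro H.Hoeffding_ineq_abs_ge[OF \<open>\<epsilon> \<ge> 0\<close>]) auto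
  have count: "real (card (extensions ({1..n}, {e \<in> vertex_pairs n. \<omega> e}) A B)) = (\<Sum>a\<in>S. X a \<omega>)" for \<omega>
  proof -
    have "extensions ({1..n}, {e \<in> vertex_pairs n. \<omega> e}) A B = {a \<in> S. ok a \<omega>}"
      using pair by (auto simp: extensions_def S_def ok_def)
    then show ?thesis using fin by (simp add: X_def sum.If_cases Int_def)
  qed
  show ?thesis
    using * unfolding gnp_def M_def[symmetric] measure_map_pmf vimage_def mem_Collect_eq count s
    by (simp add: EX)
qed

text \<open>A small set is coded by a list of length exactly \<open>m\<close>, padded with 0, which
  is not a vertex.\<close>

lemma card_small_subsets:
  "card {A. A \<subseteq> {1..n} \<and> card A \<le> m} \<le> (n + 1) ^ m"
proof -
  have "{A. A \<subseteq> {1..n} \<and> card A \<le> m} \<subseteq> (\<lambda>xs. set xs - {0}) ` {xs. set xs \<subseteq> {0..n} \<and> length xs = m}"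
  proof
    fix A assume "A \<in> {A. A \<subseteq> {1..n} \<and> card A \<le> m}"
    then have A: "A \<subseteq> {1..n}" "card A \<le> m" by auto
    have fin: "finite A" using A finite_subset by blast
    let ?xs = "sorted_list_of_set A @ replicate (m - card A) 0"
    have "A = set ?xs - {0}" "set ?xs \<subseteq> {0..n}" "length ?xs = m"
      using A fin by auto
    then show "A \<in> (\<lambda>xs. set xs - {0}) ` {xs. set xs \<subseteq> {0..n} \<and> length xs = m}" by blast
  qed
  then have "card {A. A \<subseteq> {1..n} \<and> card A \<le> m} \<le> card {xs. set xs \<subseteq> {0..n} \<and> length xs = m}"
    by (intro surj_card_le finite_lists_length_eq) auto
  then show ?thesis by (simp add: card_lists_length_eq)
qed

text \<open>A union bound over pairs \<open>(A, B)\<close>. Hoeffding centres the count at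
  \<open>s * q\<close>, with \<open>s\<close> the number of candidate vertices, while
  quasirandomness centres it at \<open>n * q\<close>; the two differ by at most
  \<open>2 * m\<close>, and half of the permitted deviation is reserved for this.\<close>

lemma prob_not_quasirandom_le:
  assumes p: "0 < p" "p < 1" and n: "n \<ge> 1" "n \<ge> m" "n \<ge> 4 * m * Suc m"
  shows "measure_pmf.prob (gnp n p) {G. \<not> quasirandom p m G}
     \<le> 2 * real (n + 1) ^ (2 * m) * exp (- (inverse (Suc m))\<^sup>2 / 2 * n)"
proof -
  define \<delta> where "\<delta> = inverse (real (Suc m))"
  define P where "P = {(A, B). A \<subseteq> {1..n} \<and> B \<subseteq> {1..n} \<and> A \<inter> B = {} \<and> card A \<le> m \<and> card B \<le> m}"
  define D where "D = (\<lambda>(A, B). {G :: nat ugraph.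
     \<bar>real (card (extensions G A B)) - real (card ({1..n} - (A \<union> B))) * (p ^ card A * (1 - p) ^ card B)\<bar> \<ge> \<delta> * n / 2})"
  have \<delta>: "\<delta> > 0" by (simp add: \<delta>_def)
  \<comment> \<open>This is where the threshold \<open>4 * m * Suc m\<close> comes from.\<close>
  have mn: "2 * real m \<le> \<delta> * n / 2"
  proof -
    have "4 * real m * real (Suc m) \<le> real n" using n(3) by (metis of_nat_le_iff of_nat_mult of_nat_numeral)
    then show ?thesis by (simp add: \<delta>_def field_simps)
  qed
  have P_sub: "P \<subseteq> {A. A \<subseteq> {1..n} \<and> card A \<le> m} \<times> {A. A \<subseteq> {1..n} \<and> card A \<le> m}"
    by (auto simp: P_def)
  have finP: "finite P" by (rule finite_subset[OF P_sub]) simp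
  have "card P \<le> (n + 1) ^ m * (n + 1) ^ m"
    using card_mono[OF _ P_sub] card_small_subsets[of n m] by (simp add: card_cartesian_product) (meson le_trans mult_le_mono)
  then have cardP: "card P \<le> (n + 1) ^ (2 * m)" by (simp add: power_add mult_2)
  have small: "real n - real (card ({1..n} - (A \<union> B))) \<le> 2 * real m" "card ({1..n} - (A \<union> B)) \<le> n" if "(A, B) \<in> P" for A B
  proof -
    have "A \<union> B \<subseteq> {1..n}" using that by (auto simp: P_def)
    then have "card ({1..n} - (A \<union> B)) = n - card (A \<union> B)" "card (A \<union> B) \<le> n"
      using card_Diff_subset[of "A \<union> B" "{1..n}"] card_mono[of "{1..n}" "A \<union> B"] finite_subset by auto
    moreover have "card (A \<union> B) \<le> 2 * m" using that card_Un_le[of A B] by (auto simp: P_def)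
    ultimately show "real n - real (card ({1..n} - (A \<union> B))) \<le> 2 * real m" "card ({1..n} - (A \<union> B)) \<le> n" by auto
  qed
  have cover: "G \<in> (\<Union>AB\<in>P. D AB)" if G: "G \<in> set_pmf (gnp n p)" "\<not> quasirandom p m G" for G
  proof -
    have fstG: "fst G = {1..n}" and "snd G \<subseteq> vertex_pairs n" using set_pmf_gnp[OF G(1)] by auto
    then have "{a} \<notin> snd G" for a by (auto simp: vertex_pairs_def)
    then obtain A B where AB: "A \<subseteq> {1..n}" "B \<subseteq> {1..n}" "A \<inter> B = {}" "card A \<le> m" "card B \<le> m"
      and dev: "\<not> \<bar>card (extensions G A B) / n - p ^ card A * (1 - p) ^ card B\<bar> \<le> \<delta>"
      using G(2) n(2) unfolding quasirandom_def fstG \<delta>_def by auto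
    define q where "q = p ^ card A * (1 - p) ^ card B"
    define s where "s = real (card ({1..n} - (A \<union> B)))"
    have q: "0 \<le> q" "q \<le> 1" using p by (auto simp: q_def intro!: mult_le_one power_le_one)
    have "\<bar>card (extensions G A B) / n - q\<bar> = \<bar>card (extensions G A B) - n * q\<bar> / n"
      using n(1) by (simp add: field_simps abs_divide)
    then have big: "\<bar>card (extensions G A B) - n * q\<bar> \<ge> \<delta> * n"
      using dev n(1) by (simp add: q_def field_simps)
    have inP: "(A, B) \<in> P" using AB by (auto simp: P_def)
    have "(real n - s) * q \<le> 2 * real m * 1"
      using small(1)[OF inP] q by (intro mult_mono) (auto simp: s_def)
    moreover have "0 \<le> (real n - s) * q" using small(2)[OF inP] q by (auto simp: s_def)
    ultimately have "\<bar>real n * q - s * q\<bar> \<le> \<delta> * n / 2" using mn by (simp add: left_diff_distrib)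
    then have "\<bar>card (extensions G A B) - s * q\<bar> \<ge> \<delta> * n / 2" using big by linarith
    then have "G \<in> D (A, B)" by (simp add: D_def s_def q_def)
    then show ?thesis using inP by blast
  qed
  have bound: "measure_pmf.prob (gnp n p) (D AB) \<le> 2 * exp (- \<delta>\<^sup>2 / 2 * n)" if AB: "AB \<in> P" for AB
  proof -
    obtain A B where [simp]: "AB = (A, B)" by (cases AB)
    define s where "s = real (card ({1..n} - (A \<union> B)))"
    have AB': "A \<subseteq> {1..n}" "B \<subseteq> {1..n}" "A \<inter> B = {}" using AB by (auto simp: P_def)
    \<comment> \<open>Together with the threshold this gives \<open>2 * m < n\<close>, so some
      vertex lies outside \<open>A \<union> B\<close>, as the deviation bound requires.\<close>
    have "\<delta> \<le> 1" by (simp add: \<delta>_def divide_simps)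
    then have "\<delta> * n / 2 \<le> real n / 2" using mult_right_mono[of \<delta> 1 "real n"] by simp
    then have "2 * real m < n" using mn n(1) by linarith
    then have s: "0 < s" "s \<le> n"
      using small[of A B] AB unfolding s_def by simp_all
    then have card: "card (A \<union> B) < n"
      unfolding s_def using AB' by (subst (asm) card_Diff_subset) (auto intro: finite_subset)
    have "measure_pmf.prob (gnp n p) (D AB) \<le> 2 * exp (- 2 * (\<delta> * n / 2)\<^sup>2 / s)"
      unfolding D_def s_def using prob_extension_deviation[OF p AB' card, of "\<delta> * n / 2"] \<delta> by simp
    also have "\<dots> \<le> 2 * exp (- \<delta>\<^sup>2 / 2 * n)"
    proof -
      have "\<delta>\<^sup>2 / 2 * n \<le> 2 * (\<delta> * n / 2)\<^sup>2 / s"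
        using s \<delta> by (simp add: field_simps power2_eq_square)
      then show ?thesis by simp
    qed
    finally show ?thesis .
  qed
  have "measure_pmf.prob (gnp n p) {G. \<not> quasirandom p m G} \<le> measure_pmf.prob (gnp n p) (\<Union>AB\<in>P. D AB)"
    by (rule measure_pmf.finite_measure_mono_AE) (use cover in \<open>auto simp: AE_measure_pmf_iff\<close>)
  also have "\<dots> \<le> (\<Sum>AB\<in>P. measure_pmf.prob (gnp n p) (D AB))"
    by (rule measure_pmf.finite_measure_subadditive_finite) (use finP in auto)
  also have "\<dots> \<le> card P * (2 * exp (- \<delta>\<^sup>2 / 2 * n))"
    using bound by (intro sum_bounded_above)
  also have "\<dots> \<le> real ((n + 1) ^ (2 * m)) * (2 * exp (- \<delta>\<^sup>2 / 2 * n))"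
    using cardP by (intro mult_right_mono) (simp_all only: of_nat_le_iff, simp)
  finally show ?thesis by (simp add: \<delta>_def mult_ac)
qed

lemma poly_times_exp_tendsto_0:
  fixes c :: real
  assumes "c > 0"
  shows "(\<lambda>n. real (n + 1) ^ k * exp (- c * real n)) \<longlonglongrightarrow> 0"
proof -
  have lim: "((\<lambda>x::real. x ^ k / exp x) \<longlongrightarrow> 0) at_top" by (rule tendsto_power_div_exp_0)
  have "filterlim (\<lambda>n. c * real (n + 1)) at_top sequentially"
    using assms by real_asymp
  \<comment> \<open>Substituting \<open>x = c * (n + 1)\<close> into the standard limit leaves
    exactly the factor \<open>exp c / c ^ k\<close> to compensate.\<close>
  from tendsto_mult_left[OF filterlim_compose[OF lim this], of "exp c / c ^ k"]
  have "(\<lambda>n. exp c / c ^ k * ((c * real (n + 1)) ^ k / exp (c * real (n + 1)))) \<longlonglongrightarrow> 0"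
    by simp
  moreover have "exp c / c ^ k * ((c * real (n + 1)) ^ k / exp (c * real (n + 1)))
      = real (n + 1) ^ k * exp (- c * real n)" for n
  proof -
    have "exp (c * real (n + 1)) = exp c * exp (c * real n)"
      by (simp add: ring_distribs exp_add mult.commute)
    then show ?thesis
      unfolding power_mult_distrib using assms by (simp add: exp_minus field_simps)
  qed
  ultimately show ?thesis by simp
qed

text \<open>The arbitrary weight \<open>n powr \<kappa>\<close> accounts for the polynomially large
  values a term may take on exceptional graphs; \<open>\<kappa> = 0\<close> gives the bare
  probability.\<close>

lemma prob_not_quasirandom_tendsto_0:
  assumes p: "0 < p" "p < 1"
  shows "(\<lambda>n. real n powr \<kappa> * measure_pmf.prob (gnp n p) {G. \<not> quasirandom p m G}) \<longlonglongrightarrow> 0"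
proof (rule tendsto_sandwich[of "\<lambda>_. 0"])
  define k where "k = nat \<lceil>\<bar>\<kappa>\<bar>\<rceil>"
  define c where "c = (inverse (real (Suc m)))\<^sup>2 / 2"
  show "\<forall>\<^sub>F n in sequentially. real n powr \<kappa> * measure_pmf.prob (gnp n p) {G. \<not> quasirandom p m G}
      \<le> 2 * (real (n + 1) ^ (k + 2 * m) * exp (- c * real n))"
  proof (rule eventually_sequentiallyI[of "4 * m * Suc m + m + 1"])
    fix n assume n: "4 * m * Suc m + m + 1 \<le> n"
    have "real n powr \<kappa> \<le> real (n + 1) powr real k"
    proof -
      have "real n powr \<kappa> \<le> real n powr real k"
        using n by (intro powr_mono) (auto simp: k_def, linarith)
      also have "\<dots> \<le> real (n + 1) powr real k" by (intro powr_mono2) auto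
      finally show ?thesis .
    qed
    also have "\<dots> = real (n + 1) ^ k" by (simp add: powr_realpow)
    finally have "real n powr \<kappa> * measure_pmf.prob (gnp n p) {G. \<not> quasirandom p m G}
        \<le> real (n + 1) ^ k * (2 * real (n + 1) ^ (2 * m) * exp (- (inverse (Suc m))\<^sup>2 / 2 * n))"
      using n by (intro mult_mono prob_not_quasirandom_le p) auto
    then show "real n powr \<kappa> * measure_pmf.prob (gnp n p) {G. \<not> quasirandom p m G}
      \<le> 2 * (real (n + 1) ^ (k + 2 * m) * exp (- c * real n))"
      by (simp add: c_def power_add mult_ac)
  qed
  have "c > 0" by (simp add: c_def)
  from tendsto_mult_left[OF poly_times_exp_tendsto_0[OF this], of 2]
  show "(\<lambda>n. 2 * (real (n + 1) ^ (k + 2 * m) * exp (- c * real n))) \<longlonglongrightarrow> 0" by simp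
qed auto

section \<open>Moments of closed terms\<close>

lemma type_of_empty: "type_of {} G \<sigma> = ({}, {})"
  by (simp add: type_of_def)

lemma closed_value_pow_bounded:
  assumes "\<tau> \<in> Agg F_rlpoly"
  shows "\<exists>K. \<forall>n\<ge>2. \<forall>G\<in>set_pmf (gnp n p). 0 \<le> closed_value G \<tau> \<and> closed_value G \<tau> \<le> real n powr K"
proof -
  obtain K where K: "\<And>(G :: nat ugraph) \<sigma>. finite (fst G) \<Longrightarrow> card (fst G) \<ge> 2 \<Longrightarrow>
      pow_bounded K (card (fst G)) (eval_term G \<sigma> \<tau>)"
    using eval_term_pow_bounded[OF assms] by blast
  show ?thesis
  proof (intro exI allI impI ballI)
    fix n and G :: "nat ugraph"
    assume n: "n \<ge> 2" and G: "G \<in> set_pmf (gnp n p)"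
    have "pow_bounded K n (closed_value G \<tau>)"
      using K[of G "\<lambda>_. undefined"] n set_pmf_gnp(1)[OF G] by (simp add: closed_value_def)
    then have "closed_value G \<tau> = 0 \<or> real n powr (- K) \<le> closed_value G \<tau> \<and> closed_value G \<tau> \<le> real n powr K"
      using pow_bounded_powr[OF n] by blast
    moreover have "real n powr (- K) > 0" "real n powr K > 0" using n by simp_all
    ultimately show "0 \<le> closed_value G \<tau> \<and> closed_value G \<tau> \<le> real n powr K" by linarith
  qed
qed

text \<open>Splits a moment into its quasirandom part, at most \<open>a\<close>, and an extra cost
  \<open>b\<close> paid only on exceptional graphs.\<close>

lemma expectation_gnp_le:
  assumes "\<And>G. G \<in> set_pmf (gnp n p) \<Longrightarrow> f G \<le> a + b * indicator {G. \<not> quasirandom p m G} G"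
  shows "measure_pmf.expectation (gnp n p) f \<le> a + b * measure_pmf.prob (gnp n p) {G. \<not> quasirandom p m G}"
proof -
  note int = integrable_measure_pmf_finite[OF finite_set_pmf_gnp]
  have "measure_pmf.expectation (gnp n p) f
      \<le> measure_pmf.expectation (gnp n p) (\<lambda>G. a + b * indicator {G. \<not> quasirandom p m G} G)"
    by (rule integral_mono_AE[OF int int]) (use assms in \<open>simp add: AE_measure_pmf_iff\<close>)
  also have "\<dots> = a + b * measure_pmf.prob (gnp n p) {G. \<not> quasirandom p m G}"
    by (subst Bochner_Integration.integral_add[OF int int]) simp
  finally show ?thesis .
qed

theorem theorem5p3:
  fixes p :: real and \<tau> :: agg_term
  assumes "0 < p" and "p < 1"
    and "\<tau> \<in> Agg F_rlpoly" and "closed_term \<tau>"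
  shows
    "((\<lambda>n. measure_pmf.prob (gnp n p) {G. closed_value G \<tau> = 0}) \<longlonglongrightarrow> 1
        \<and> (\<forall>q::real. q > 0 \<longrightarrow>
             (\<lambda>n. measure_pmf.expectation (gnp n p) (\<lambda>G. \<bar>closed_value G \<tau> - 0\<bar> powr q)) \<longlonglongrightarrow> 0))
     \<or> (\<exists>c>0. \<exists>\<gamma>::real.
          poly_growth (\<lambda>n. measure_pmf.expectation (gnp n p) (\<lambda>G. closed_value G \<tau>)) c \<gamma>)"
proof -
  note p = assms(1,2)
  let ?bad = "\<lambda>m n. measure_pmf.prob (gnp n p) {G. \<not> quasirandom p m G}"
  obtain K where "\<forall>n\<ge>2. \<forall>G\<in>set_pmf (gnp n p). 0 \<le> closed_value G \<tau> \<and> closed_value G \<tau> \<le> real n powr K"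
    using closed_value_pow_bounded[OF assms(3)] by (rule exE)
  note K = this[rule_format]
  \<comment> \<open>With no variables there is only one type, so the limit is over all increasingly
    quasirandom graphs.\<close>
  have "zero_or_power (type_filter p {} ({}, {})) num_vertices
      (\<lambda>z :: nat ugraph \<times> (nat \<Rightarrow> nat). eval_term (fst z) (snd z) \<tau>)"
    by (rule eval_zero_or_power) (use assms in \<open>auto simp: closed_term_def\<close>)
  then show ?thesis
  proof (cases rule: zero_or_power_cases)
    case zero
    then obtain m where *: "\<forall>(G :: nat ugraph) \<sigma>. quasirandom p m G \<longrightarrow> \<sigma> ` {} \<subseteq> fst G \<longrightarrow>
        type_of {} G \<sigma> = ({}, {}) \<longrightarrow> eval_term (fst (G, \<sigma>)) (snd (G, \<sigma>)) \<tau> = 0"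
      unfolding eventually_type_filter by (rule exE)
    have m: "closed_value G \<tau> = 0" if "quasirandom p m G" for G :: "nat ugraph"
      using *[rule_format, OF that, of "\<lambda>_. undefined"] by (simp add: closed_value_def type_of_empty)
    have "(\<lambda>n. measure_pmf.prob (gnp n p) {G. closed_value G \<tau> = 0}) \<longlonglongrightarrow> 1"
    proof (rule tendsto_sandwich[where h = "\<lambda>_. 1"])
      \<comment> \<open>The factor \<open>real n powr 0\<close> is the weight with
        \<open>\<kappa> = 0\<close>; it equals 1 only from \<open>n = 1\<close> on.\<close>
      show "\<forall>\<^sub>F n in sequentially. 1 - real n powr 0 * ?bad m n
          \<le> measure_pmf.prob (gnp n p) {G. closed_value G \<tau> = 0}"
      proof (rule eventually_sequentiallyI[of 1])
        fix n :: nat assume "1 \<le> n"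
        have "measure_pmf.prob (gnp n p) (UNIV - {G. \<not> quasirandom p m G})
            \<le> measure_pmf.prob (gnp n p) {G. closed_value G \<tau> = 0}"
          by (rule measure_pmf.finite_measure_mono) (use m in auto)
        then show "1 - real n powr 0 * ?bad m n \<le> measure_pmf.prob (gnp n p) {G. closed_value G \<tau> = 0}"
          using measure_pmf.prob_compl[of "{G. \<not> quasirandom p m G}" "gnp n p"] \<open>1 \<le> n\<close> by simp
      qed
      show "(\<lambda>n. 1 - real n powr 0 * ?bad m n) \<longlonglongrightarrow> 1"
        using tendsto_diff[OF tendsto_const prob_not_quasirandom_tendsto_0[OF p, of 0 m], of 1] by simp
    qed (auto intro: always_eventually)
    moreover have "(\<lambda>n. measure_pmf.expectation (gnp n p) (\<lambda>G. \<bar>closed_value G \<tau> - 0\<bar> powr q)) \<longlonglongrightarrow> 0"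
      if "q > 0" for q :: real
    proof (rule tendsto_sandwich[of "\<lambda>_. 0"])
      show "\<forall>\<^sub>F n in sequentially. measure_pmf.expectation (gnp n p) (\<lambda>G. \<bar>closed_value G \<tau> - 0\<bar> powr q)
          \<le> real n powr (K * q) * ?bad m n"
      proof (rule eventually_sequentiallyI[of 2])
        fix n :: nat assume n: "2 \<le> n"
        have "\<bar>closed_value G \<tau> - 0\<bar> powr q \<le> 0 + real n powr (K * q) * indicator {G. \<not> quasirandom p m G} G"
          if "G \<in> set_pmf (gnp n p)" for G
        proof (cases "quasirandom p m G")
          case False
          have "\<bar>closed_value G \<tau>\<bar> powr q \<le> (real n powr K) powr q"
            using K[OF n that] \<open>q > 0\<close> by (intro powr_mono2) auto
          then show ?thesis using False by (simp add: powr_powr)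
        qed (simp add: m)
        from expectation_gnp_le[OF this]
        show "measure_pmf.expectation (gnp n p) (\<lambda>G. \<bar>closed_value G \<tau> - 0\<bar> powr q)
          \<le> real n powr (K * q) * ?bad m n" by simp
      qed
      show "(\<lambda>n. real n powr (K * q) * ?bad m n) \<longlonglongrightarrow> 0"
        by (rule prob_not_quasirandom_tendsto_0[OF p])
    qed (auto intro!: always_eventually)
    ultimately show ?thesis by blast
  next
    case (power c \<gamma>)
    have "(\<lambda>n. measure_pmf.expectation (gnp n p) (\<lambda>G. closed_value G \<tau>) / real n powr \<gamma>) \<longlonglongrightarrow> c"
      unfolding tendsto_iff dist_real_def
    proof (intro allI impI)
      fix \<epsilon> :: real assume \<epsilon>: "\<epsilon> > 0"
      then have "\<forall>\<^sub>F z in type_filter p {} ({}, {}).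
          dist (eval_term (fst z) (snd z) \<tau> / num_vertices (z :: nat ugraph \<times> (nat \<Rightarrow> nat)) powr \<gamma>) c < \<epsilon> / 2"
        by (intro tendstoD[OF power(2)]) simp
      then obtain m where *: "\<forall>(G :: nat ugraph) \<sigma>. quasirandom p m G \<longrightarrow> \<sigma> ` {} \<subseteq> fst G \<longrightarrow>
          type_of {} G \<sigma> = ({}, {}) \<longrightarrow>
          dist (eval_term (fst (G, \<sigma>)) (snd (G, \<sigma>)) \<tau> / num_vertices (G, \<sigma>) powr \<gamma>) c < \<epsilon> / 2"
        unfolding eventually_type_filter by (rule exE)
      have m: "\<bar>closed_value G \<tau> / real (card (fst G)) powr \<gamma> - c\<bar> < \<epsilon> / 2"
        if "quasirandom p m G" for G :: "nat ugraph"
        using *[rule_format, OF that, of "\<lambda>_. undefined"] by (simp add: closed_value_def type_of_empty dist_real_def)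
      \<comment> \<open>On exceptional graphs the normalised value is at most
        \<open>n powr (K - \<gamma>)\<close> and its target is \<open>c\<close>; weighted by the
        exceptional probability, both contributions vanish.\<close>
      have "(\<lambda>n. real n powr (K - \<gamma>) * ?bad m n + c * (real n powr 0 * ?bad m n)) \<longlonglongrightarrow> 0 + c * 0"
        by (intro tendsto_add tendsto_mult tendsto_const prob_not_quasirandom_tendsto_0 p)
      then have "\<forall>\<^sub>F n in sequentially. real n powr (K - \<gamma>) * ?bad m n + c * (real n powr 0 * ?bad m n) < \<epsilon> / 2"
        using \<epsilon> by (intro order_tendstoD(2)) auto
      then show "\<forall>\<^sub>F n in sequentially.
          \<bar>measure_pmf.expectation (gnp n p) (\<lambda>G. closed_value G \<tau>) / real n powr \<gamma> - c\<bar> < \<epsilon>"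
        using eventually_ge_at_top[of 2]
      proof eventually_elim
        case (elim n)
        note int = integrable_measure_pmf_finite[OF finite_set_pmf_gnp]
        let ?d = "\<lambda>G. closed_value G \<tau> / real n powr \<gamma> - c"
        have "\<bar>?d G\<bar> \<le> \<epsilon> / 2 + (real n powr (K - \<gamma>) + c) * indicator {G. \<not> quasirandom p m G} G"
          if G: "G \<in> set_pmf (gnp n p)" for G
        proof (cases "quasirandom p m G")
          case True
          then show ?thesis using m[OF True] set_pmf_gnp(1)[OF G] by simp
        next
          case False
          have "0 \<le> closed_value G \<tau> / real n powr \<gamma>" "closed_value G \<tau> / real n powr \<gamma> \<le> real n powr (K - \<gamma>)"
            using K[OF elim(2) G] by (auto simp: powr_diff divide_right_mono)
          then show ?thesis using False power(1) \<epsilon> by (simp add: abs_le_iff)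
        qed
        from expectation_gnp_le[OF this]
        have "measure_pmf.expectation (gnp n p) (\<lambda>G. \<bar>?d G\<bar>) \<le> \<epsilon> / 2 + (real n powr (K - \<gamma>) + c) * ?bad m n" .
        also have "\<dots> < \<epsilon>" using elim by (simp add: algebra_simps)
        finally have "measure_pmf.expectation (gnp n p) (\<lambda>G. \<bar>?d G\<bar>) < \<epsilon>" .
        moreover have "\<bar>measure_pmf.expectation (gnp n p) ?d\<bar> \<le> measure_pmf.expectation (gnp n p) (\<lambda>G. \<bar>?d G\<bar>)"
          by (rule integral_abs_bound)
        moreover have "measure_pmf.expectation (gnp n p) ?d
            = measure_pmf.expectation (gnp n p) (\<lambda>G. closed_value G \<tau>) / real n powr \<gamma> - c"
          by (subst Bochner_Integration.integral_diff[OF int int]) simp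
        ultimately show ?case by simp
      qed
    qed
    then show ?thesis using power(1) unfolding poly_growth_def by blast
  qed
qed

end
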